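(* Let $N\ge 2$ and suppose $(\rho,u)$ is a global classical solution, with compact support in $\Omega=\Omega(t)$, of the Euler-Poisson equations with repulsive forces, with $P=K\rho^\gamma$, $\gamma>1$, and without frictional damping, $$\rho_t+\nabla\cdot(\rho u)=0,\qquad (\rho u)_t+\nabla\cdot(\rho u\otimes u)+\nabla P=\rho\nabla\Phi,\qquad \Delta\Phi=\alpha(N)\rho .$$ Let $R(t)=\max_{x\in\Omega(t)}|x|$, let $M=\int_\Omega\rho(t,x)\,dx$ be the total mass (which is constant for any classical solution), and let $|\Omega|$ be the fixed volume of $\Omega$. Then: (1) for $N\geq3$, $$\liminf_{t\to\infty}\frac{R(t)}{t}\ \geq\ \left[\frac{\inf\bigl(2,\,N(\gamma-1),\,N-2\bigr)\,E}{M}\right]^{1/2};$$ (2) for $N=2$, $$\liminf_{t\to\infty}\frac{R(t)}{t}\ \geq\ \sqrt{\frac{1}{2M}};$$ (3) for $N\geq2$, $$\liminf_{t\to\infty}\frac{R(t)}{t}\ \geq\ \left[\frac{N K M^{\gamma-1}}{|\Omega|^{\gamma-1}}\right]^{1/2}.$$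
   Context: Here $\rho=\rho(t,x)$ is the density, $u=u(t,x)\in\mathbb{R}^N$ the velocity, $P$ the pressure, and $K\ge0$ a constant. The constant $\alpha(N)$ is $\alpha(2)=2\pi$ and $\alpha(N)=N(N-2)\pi^{N/2}/\Gamma(N/2+1)$ for $N\ge3$. The potential is given by $$\Phi(t,x)=\int_{\mathbb{R}^N}G(x-y)\rho(t,y)\,dy,\qquad G(x)=\log|x|\ (N=2),\quad G(x)=-|x|^{-(N-2)}\ (N\geq3).$$ "Global" means defined for all $t\ge0$. The total energy is $$E=E(t)=\int_{\Omega}\Bigl(\tfrac12\rho|u|^2+\tfrac{1}{\gamma-1}P-\tfrac12\rho\Phi\Bigr)dx,$$ which is constant in $t$ when there is no damping. *)

theory Defs
  imports "HOL-Analysis.Analysis"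
begin

text \<open>
  Space is \<open>real^'n\<close>, so the dimension \<open>N\<close> is \<open>CARD('n)\<close>. Fields are curried functions of
  time and space, and only their values at times \<open>t \<ge> 0\<close> matter.
\<close>

definition C1_on :: "('a::real_normed_vector \<Rightarrow> 'b::real_normed_vector) \<Rightarrow> 'a set \<Rightarrow> bool" where
  "C1_on f S \<longleftrightarrow>
     (\<exists>f'. (\<forall>x\<in>S. (f has_derivative blinfun_apply (f' x)) (at x within S)) \<and> continuous_on S f')"

definition partial :: "'n \<Rightarrow> (real^'n \<Rightarrow> real) \<Rightarrow> real^'n \<Rightarrow> real" where
  "partial i f x = deriv (\<lambda>h. f (x + h *\<^sub>R axis i 1)) 0"

text \<open>One-sided at \<open>t = 0\<close>, two-sided at \<open>t > 0\<close>.\<close>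

definition time_deriv :: "(real \<Rightarrow> real) \<Rightarrow> real \<Rightarrow> real" where
  "time_deriv f t = vector_derivative f (at t within {0..})"

definition divergence :: "(real^'n \<Rightarrow> real^'n) \<Rightarrow> real^'n \<Rightarrow> real" where
  "divergence F x = (\<Sum>j\<in>UNIV. partial j (\<lambda>y. F y $ j) x)"

definition laplacian :: "(real^'n \<Rightarrow> real) \<Rightarrow> real^'n \<Rightarrow> real" where
  "laplacian f x = (\<Sum>j\<in>UNIV. partial j (partial j f) x)"

definition alpha :: "nat \<Rightarrow> real" where
  "alpha N = (if N = 2 then 2 * pi
     else real N * (real N - 2) * pi powr (real N / 2) / Gamma (real N / 2 + 1))"

text \<open>The value at the singularity \<open>x = 0\<close> is arbitrary; it only enters under integrals.\<close>

definition G :: "real^'n \<Rightarrow> real" where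
  "G x = (if CARD('n) = 2 then ln (norm x) else - 1 / norm x ^ (CARD('n) - 2))"

definition potential :: "(real \<Rightarrow> real^'n \<Rightarrow> real) \<Rightarrow> real \<Rightarrow> real^'n \<Rightarrow> real" where
  "potential \<rho> t x = (LINT y|lborel. G (x - y) * \<rho> t y)"

definition pressure :: "real \<Rightarrow> real \<Rightarrow> (real \<Rightarrow> real^'n \<Rightarrow> real) \<Rightarrow> real \<Rightarrow> real^'n \<Rightarrow> real" where
  "pressure K \<gamma> \<rho> t x = K * \<rho> t x powr \<gamma>"

text \<open>
  The momentum equation is stated componentwise: the \<open>i\<close>-th component of the divergence of the
  tensor \<open>\<rho> u \<otimes> u\<close> is the divergence of the vector field \<open>\<rho> u\<^sub>i u\<close>.
\<close>

definition euler_poisson_global_classical ::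
  "real \<Rightarrow> real \<Rightarrow> (real \<Rightarrow> real^'n \<Rightarrow> real) \<Rightarrow> (real \<Rightarrow> real^'n \<Rightarrow> real^'n) \<Rightarrow> bool" where
  "euler_poisson_global_classical K \<gamma> \<rho> u \<longleftrightarrow>
     C1_on (\<lambda>(t, x). \<rho> t x) ({0..} \<times> UNIV) \<and>
     C1_on (\<lambda>(t, x). u t x) ({0..} \<times> UNIV) \<and>
     (\<forall>t\<ge>0. C1_on (potential \<rho> t) UNIV \<and> (\<forall>i. C1_on (partial i (potential \<rho> t)) UNIV)) \<and>
     (\<forall>t\<ge>0. \<forall>x. 0 \<le> \<rho> t x) \<and>
     (\<forall>t\<ge>0. \<forall>x.
        time_deriv (\<lambda>s. \<rho> s x) t + divergence (\<lambda>y. \<rho> t y *\<^sub>R u t y) x = 0) \<and>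
     (\<forall>t\<ge>0. \<forall>x i.
        time_deriv (\<lambda>s. \<rho> s x * u s x $ i) t
          + divergence (\<lambda>y. (\<rho> t y * u t y $ i) *\<^sub>R u t y) x
          + partial i (pressure K \<gamma> \<rho> t) x
        = \<rho> t x * partial i (potential \<rho> t) x) \<and>
     (\<forall>t\<ge>0. \<forall>x. laplacian (potential \<rho> t) x = alpha CARD('n) * \<rho> t x)"

text \<open>
  The support of the density is compact uniformly on every bounded time interval (so no mass
  escapes to, or enters from, infinity in finite time), and at each time it lies in the nonempty
  compact set \<open>\<Omega> t\<close>, on which the maximum of \<open>norm\<close> therefore exists.
\<close>

definition compactly_supported_in ::
  "(real \<Rightarrow> real^'n \<Rightarrow> real) \<Rightarrow> (real \<Rightarrow> (real^'n) set) \<Rightarrow> bool" where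
  "compactly_supported_in \<rho> \<Omega> \<longleftrightarrow>
     (\<forall>T. bounded (\<Union>t\<in>{0..T}. {x. \<rho> t x \<noteq> 0})) \<and>
     (\<forall>t\<ge>0. compact (\<Omega> t) \<and> \<Omega> t \<noteq> {} \<and> closure {x. \<rho> t x \<noteq> 0} \<subseteq> \<Omega> t)"

definition radius :: "(real \<Rightarrow> (real^'n) set) \<Rightarrow> real \<Rightarrow> real" where
  "radius \<Omega> t = (SUP x\<in>\<Omega> t. norm x)"

definition mass :: "(real \<Rightarrow> (real^'n) set) \<Rightarrow> (real \<Rightarrow> real^'n \<Rightarrow> real) \<Rightarrow> real \<Rightarrow> real" where
  "mass \<Omega> \<rho> t = (LINT x:\<Omega> t|lborel. \<rho> t x)"

definition energy :: "real \<Rightarrow> real \<Rightarrow> (real \<Rightarrow> (real^'n) set) \<Rightarrow> (real \<Rightarrow> real^'n \<Rightarrow> real)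
    \<Rightarrow> (real \<Rightarrow> real^'n \<Rightarrow> real^'n) \<Rightarrow> real \<Rightarrow> real" where
  "energy K \<gamma> \<Omega> \<rho> u t =
     (LINT x:\<Omega> t|lborel. 1 / 2 * \<rho> t x * (norm (u t x))\<^sup>2
        + 1 / (\<gamma> - 1) * pressure K \<gamma> \<rho> t x - 1 / 2 * \<rho> t x * potential \<rho> t x)"

end

theory Submission
  imports Defs
begin

text \<open>
  Let \<open>H = \<integral> \<rho> |x|\<^sup>2\<close>, so that \<open>H \<le> M R\<^sup>2\<close>. The two conservation laws give
  \<open>H' = 2 \<integral> \<rho> x \<bullet> u\<close> and \<open>H'' = 2 (\<integral> \<rho> |u|\<^sup>2 + N \<integral> P + \<integral> \<rho> x \<bullet> \<nabla>\<Phi>)\<close>. The virial term is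
  computed without differentiating the kernel \<open>G\<close>: with \<open>B(f, g) = \<integral>\<integral> f(x) G(x - y) g(y)\<close>, differentiating
  the scaling law of \<open>B(\<rho>(\<lambda> \<cdot>), \<rho>(\<lambda> \<cdot>))\<close> at \<open>\<lambda> = 1\<close> yields \<open>\<integral> \<rho> x \<bullet> \<nabla>\<Phi> = - (N - 2) / 2 B(\<rho>, \<rho>)\<close> for
  \<open>N \<ge> 3\<close> and \<open>M\<^sup>2 / 2\<close> for \<open>N = 2\<close>. Part (1) follows from \<open>H'' \<ge> 2 inf(2, N (\<gamma> - 1), N - 2) E\<close> and
  conservation of energy, part (3) from Jensen's inequality for \<open>\<integral> \<rho>\<^sup>\<gamma>\<close>.

  In part (2) the bound \<open>H'' \<ge> M\<^sup>2\<close> alone would only give the constant \<open>sqrt (M / 2)\<close>, which is too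
  small when \<open>M < 1\<close>. Keeping the kinetic term and using \<open>(H')\<^sup>2 \<le> 4 H \<integral> \<rho> |u|\<^sup>2\<close> one finds that
  \<open>L = sqrt (H + 1)\<close> satisfies \<open>L'' \<ge> M\<^sup>2 / (2 L)\<close>, hence \<open>L / t\<close> tends to infinity.
\<close>

section \<open>Differentiation under the integral and integration by parts\<close>

text \<open>Therefore every derivative is put on the density. On functions supported in a fixed
  ball, B is bounded by a constant times the product of the sup bounds, and this bound uses only
  that \<open>G\<close> is integrable on balls. As B is also symmetric, B(f, f) can be
  differentiated along a C1 curve f by the product rule. Two curves matter: the dilations of \<rho>
  yield the virial term, and the time evolution yields d/dt B(\<rho>, \<rho>) = 2 int \<rho> u .
  grad \<Phi>, the nonlocal ingredient of energy conservation. The other obstacle is the vacuum,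
  where \<rho> vanishes: the chain rule for \<open>\<rho> powr \<gamma>\<close> survives there
  because \<gamma> > 1. The rest follows from weak forms of the two laws, with test functions 1,
  |x|^2, |u|^2, \<Phi> for the continuity equation and x_i, u_i for the momentum equation.\<close>

lemma continuous_on_section:
  assumes "continuous_on (S \<times> UNIV) (\<lambda>(s, x). f s x)" and "s \<in> S"
  shows "continuous_on UNIV (f s)"
proof -
  have "continuous_on UNIV (\<lambda>x. (\<lambda>(s, x). f s x) (s, x))"
    by (rule continuous_on_compose2[OF assms(1)]) (use assms(2) in \<open>auto intro: continuous_on_Pair\<close>)
  then show ?thesis by simp
qed

lemma integrable_compact_support:
  fixes f :: "'a::euclidean_space \<Rightarrow> real"
  assumes "continuous_on UNIV f" and "\<And>x. norm x > r \<Longrightarrow> f x = 0"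
  shows "integrable lborel f"
proof -
  have "integrable lborel (\<lambda>x. indicator (cball 0 r) x *\<^sub>R f x)"
    by (rule borel_integrable_compact) (auto intro: continuous_on_subset[OF assms(1)])
  moreover have "(\<lambda>x. indicator (cball 0 r) x *\<^sub>R f x) = f"
    using assms(2) by (auto simp: fun_eq_iff indicator_def not_le)
  ultimately show ?thesis by simp
qed

lemma integral_compact_support:
  fixes f :: "'a::euclidean_space \<Rightarrow> real"
  assumes "continuous_on UNIV f" and "\<And>x. norm x > r \<Longrightarrow> f x = 0" and "cball 0 r \<subseteq> S"
  shows "integral S f = (LINT x|lborel. f x)"
proof -
  have "(LINT x|lborel. f x) = integral UNIV f"
    using integral_lborel[OF integrable_compact_support[OF assms(1,2)]] by simp
  also have "\<dots> = integral UNIV (\<lambda>x. if x \<in> S then f x else 0)"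
    by (rule arg_cong[where f = "integral UNIV"]) (use assms in \<open>fastforce simp: fun_eq_iff not_le\<close>)
  also have "\<dots> = integral S f" by (rule integral_restrict_UNIV)
  finally show ?thesis ..
qed

text \<open>A box around the support turns both integrals into integrals over a compact set, where
  the Leibniz rule applies. The derivative vanishes outside the same ball, because \<open>f\<close>
  is identically zero in time there.\<close>

lemma has_real_derivative_LINT_compact_support:
  fixes f :: "real \<Rightarrow> 'a::euclidean_space \<Rightarrow> real"
  assumes t: "a < b" "t \<in> {a..b}"
    and der: "\<And>s x. s \<in> {a..b} \<Longrightarrow> ((\<lambda>s. f s x) has_real_derivative f' s x) (at s within {a..b})"
    and cont: "\<And>s. s \<in> {a..b} \<Longrightarrow> continuous_on UNIV (f s)"
    and cont': "continuous_on ({a..b} \<times> UNIV) (\<lambda>(s, x). f' s x)"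
    and supp: "\<And>s x. s \<in> {a..b} \<Longrightarrow> norm x > r \<Longrightarrow> f s x = 0"
  shows "((\<lambda>s. LINT x|lborel. f s x) has_real_derivative (LINT x|lborel. f' t x)) (at t within {a..b})"
proof -
  obtain c where c: "cball (0::'a) r \<subseteq> cbox (- c) c"
    using bounded_subset_cbox_symmetric[OF bounded_cball] by blast
  have supp': "f' s x = 0" if "s \<in> {a..b}" "norm x > r" for s x
  proof -
    have "((\<lambda>s. 0) has_real_derivative f' s x) (at s within {a..b})"
      by (rule has_field_derivative_transform_within[OF der[OF that(1)] zero_less_one that(1)])
         (use supp that in auto)
    then show ?thesis
      using vector_derivative_unique_within_closed_interval[of a b s "\<lambda>_. 0" "f' s x" 0] t that
      by (auto simp: has_real_derivative_iff_has_vector_derivative)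
  qed
  have "((\<lambda>s. integral (cbox (-c) c) (f s)) has_real_derivative integral (cbox (-c) c) (f' t))
      (at t within {a..b})"
  proof (rule leibniz_rule_field_derivative[OF der _ _ t(2)])
    show "f s integrable_on cbox (-c) c" if "s \<in> {a..b}" for s
      by (rule integrable_continuous, rule continuous_on_subset[OF cont[OF that]]) auto
    show "continuous_on ({a..b} \<times> cbox (- c) c) (\<lambda>(x, t). f' x t)"
      by (rule continuous_on_subset[OF cont']) auto
  qed auto
  moreover have "integral (cbox (-c) c) (f s) = (LINT x|lborel. f s x)" if "s \<in> {a..b}" for s
    using integral_compact_support[OF cont[OF that] supp[OF that] c] .
  moreover have "continuous_on UNIV (f' t)"
    using continuous_on_section[OF cont' t(2)] .
  then have "integral (cbox (-c) c) (f' t) = (LINT x|lborel. f' t x)"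
    by (rule integral_compact_support[OF _ _ c]) (use supp' t in auto)
  ultimately show ?thesis
    using has_field_derivative_transform_within[OF _ zero_less_one t(2)] by (metis (no_types, lifting))
qed

lemma at_within_Icc_eq_Ici:
  fixes t :: real
  assumes "t < T"
  shows "at t within {a..T} = at t within {a..}"
  by (rule at_within_nhd[of t "{..<T}"]) (use assms in auto)

text \<open>\<open>partial\<close> is built on \<open>deriv\<close>, whose value means nothing
  without differentiability. The relational form carries existence along, so that product and sum
  rules compose.\<close>

definition has_partial :: "'n::finite \<Rightarrow> (real^'n \<Rightarrow> real) \<Rightarrow> (real^'n \<Rightarrow> real) \<Rightarrow> bool" where
  "has_partial i f f' \<longleftrightarrow>
     (\<forall>x. ((\<lambda>h. f (x + h *\<^sub>R axis i 1)) has_real_derivative f' x) (at 0))"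

section \<open>Calculus of coordinatewise derivatives\<close>

lemma has_partial_imp_partial: "has_partial i f f' \<Longrightarrow> partial i f = f'"
  unfolding has_partial_def partial_def by (auto simp: fun_eq_iff intro!: DERIV_imp_deriv)

lemma has_partial_from_derivative:
  assumes "\<And>x. (f has_derivative f' x) (at x)"
  shows "has_partial i f (\<lambda>x. f' x (axis i 1))"
  unfolding has_partial_def
proof
  fix x :: "real^'a"
  interpret f': bounded_linear "f' x" using assms by (rule has_derivative_bounded_linear)
  have "((\<lambda>h::real. x + h *\<^sub>R axis i 1) has_derivative (\<lambda>h. h *\<^sub>R axis i 1)) (at 0)"
    by (auto intro!: derivative_eq_intros)
  from has_derivative_compose[OF this, of f "f' x"] assms[of x]
  show "((\<lambda>h. f (x + h *\<^sub>R axis i 1)) has_real_derivative f' x (axis i 1)) (at 0)"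
    by (simp add: has_field_derivative_def f'.scaleR mult_commute_abs)
qed

lemma has_partial_mult:
  assumes "has_partial i f f'" "has_partial i g g'"
  shows "has_partial i (\<lambda>x. f x * g x) (\<lambda>x. f' x * g x + f x * g' x)"
  using assms unfolding has_partial_def by (auto intro!: derivative_eq_intros)

lemma has_partial_sum:
  assumes "\<And>k. k \<in> A \<Longrightarrow> has_partial i (f k) (f' k)"
  shows "has_partial i (\<lambda>x. \<Sum>k\<in>A. f k x) (\<lambda>x. \<Sum>k\<in>A. f' k x)"
  using assms unfolding has_partial_def by (auto intro!: DERIV_sum)

lemma has_partial_const: "has_partial i (\<lambda>x. c) (\<lambda>x. 0)"
  unfolding has_partial_def by auto

lemma has_partial_nth: "has_partial i (\<lambda>x. x $ j) (\<lambda>x. if i = j then 1 else 0)"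
  unfolding has_partial_def by (auto simp: axis_def intro!: derivative_eq_intros)

lemma has_partial_inner_self: "has_partial j (\<lambda>x. x \<bullet> x) (\<lambda>x. 2 * x $ j)"
proof -
  have "(\<Sum>i\<in>UNIV. (if j = i then 1 else 0) * x $ i + x $ i * (if j = i then 1 else 0)) = 2 * x $ j" for x :: "real^'a"
    by (simp add: sum.distrib if_distrib[of "\<lambda>a. a * _"] if_distrib[of "(*) _"] cong: if_cong)
  moreover have "has_partial j (\<lambda>x. \<Sum>i\<in>UNIV. x $ i * x $ i)
      (\<lambda>x::real^'a. \<Sum>i\<in>UNIV. (if j = i then 1 else 0) * x $ i + x $ i * (if j = i then 1 else 0))"
    by (intro has_partial_sum has_partial_mult has_partial_nth)
  ultimately show ?thesis by (simp add: inner_vec_def)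
qed

text \<open>For measurable \<open>f\<close> this is invariance of Lebesgue measure. Otherwise the
  translate is not measurable either, and both integrals take the default value 0.\<close>

lemma LINT_translate:
  fixes f :: "'a::euclidean_space \<Rightarrow> real"
  shows "(LINT x|lborel. f (c + x)) = (LINT x|lborel. f x)"
proof (cases "f \<in> borel_measurable borel")
  case True
  have "(LINT x|lborel. f x) = (LINT x|distr lborel borel ((+) c). f x)"
    by (simp add: lborel_distr_plus)
  also have "\<dots> = (LINT x|lborel. f (c + x))"
    by (subst integral_distr) (use True in auto)
  finally show ?thesis ..
next
  case False
  have "(\<lambda>x. f (c + x)) \<notin> borel_measurable borel"
  proof
    assume "(\<lambda>x. f (c + x)) \<in> borel_measurable borel"
    then have "(\<lambda>x. f (c + (x - c))) \<in> borel_measurable borel"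
      by (rule measurable_compose[rotated]) auto
    with False show False by simp
  qed
  with False show ?thesis
    by (metis borel_measurable_integrable lborel_def measurable_lborel2 not_integrable_integral_eq)
qed

text \<open>Instead of Fubini and the one-dimensional fundamental theorem, the integral of
  \<open>f (x + s *\<^sub>R e)\<close>, with \<open>e\<close> the i-th axis vector, is
  differentiated at s = 0: it is constant in s by translation invariance, and its derivative is the
  integral of \<open>f'\<close>.\<close>

lemma LINT_partial_eq_0:
  fixes f :: "real^'n \<Rightarrow> real"
  assumes der: "has_partial i f f'" and cont: "continuous_on UNIV f" "continuous_on UNIV f'"
    and supp: "\<And>x. norm x > r \<Longrightarrow> f x = 0"
  shows "(LINT x|lborel. f' x) = 0"
proof -
  let ?e = "axis i 1 :: real^'n"
  have der': "((\<lambda>s. f (x + s *\<^sub>R ?e)) has_real_derivative f' (x + s *\<^sub>R ?e)) (at s within S)" for x s S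
  proof -
    have "((\<lambda>h. f (x + s *\<^sub>R ?e + h *\<^sub>R ?e)) has_real_derivative f' (x + s *\<^sub>R ?e)) (at 0)"
      using der unfolding has_partial_def by blast
    then have "((\<lambda>h. f (x + (h + s) *\<^sub>R ?e)) has_real_derivative f' (x + s *\<^sub>R ?e)) (at 0)"
      by (simp add: algebra_simps)
    then show ?thesis
      using DERIV_shift[of "\<lambda>h. f (x + h *\<^sub>R ?e)" _ 0 s]
      by (auto intro: has_field_derivative_at_within)
  qed
  have "((\<lambda>s. LINT x|lborel. f (x + s *\<^sub>R ?e)) has_real_derivative (LINT x|lborel. f' (x + 0 *\<^sub>R ?e)))
      (at 0 within {-1..1})"
  \<comment> \<open>Shifts by |s| <= 1 enlarge the supporting ball by at most 1.\<close>
  proof (rule has_real_derivative_LINT_compact_support[where r = "r + 1"])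
    show "continuous_on UNIV (\<lambda>x. f (x + s *\<^sub>R ?e))" for s
      by (rule continuous_on_compose2[OF cont(1)]) (auto intro!: continuous_intros)
    show "continuous_on ({- 1..1} \<times> UNIV) (\<lambda>(s, x). f' (x + s *\<^sub>R ?e))"
      unfolding split_beta by (rule continuous_on_compose2[OF cont(2)]) (auto intro!: continuous_intros)
    show "f (x + s *\<^sub>R ?e) = 0" if "s \<in> {-1..1}" "norm x > r + 1" for s x
    proof (rule supp)
      have "norm (s *\<^sub>R ?e) \<le> 1" using that by auto
      then show "r < norm (x + s *\<^sub>R ?e)"
        using norm_triangle_ineq4[of "x + s *\<^sub>R ?e" "s *\<^sub>R ?e"] that by simp
    qed
  qed (use der' in auto)
  moreover have "(LINT x|lborel. f (x + s *\<^sub>R ?e)) = (LINT x|lborel. f x)" for s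
    using LINT_translate[of f "s *\<^sub>R ?e"] by (simp add: add.commute)
  ultimately have "((\<lambda>s. LINT x|lborel. f x) has_vector_derivative (LINT x|lborel. f' x)) (at 0 within {-1..1})"
    by (simp add: has_real_derivative_iff_has_vector_derivative)
  from vector_derivative_unique_within_closed_interval[unfolded cbox_interval, OF _ _ this has_vector_derivative_const]
  show ?thesis by auto
qed

lemma has_partial_support:
  assumes "has_partial i f f'" and supp: "\<And>x. norm x > r \<Longrightarrow> f x = 0" and x: "norm x > r"
  shows "f' x = 0"
proof -
  have "((\<lambda>h. f (x + h *\<^sub>R axis i 1)) has_real_derivative f' x) (at 0)"
    using assms(1) unfolding has_partial_def by blast
  moreover have "((\<lambda>h. f (x + h *\<^sub>R axis i 1)) has_real_derivative 0) (at 0)"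
  proof (rule has_field_derivative_transform_within[of "\<lambda>_. 0" _ _ _ "norm x - r"])
    fix h :: real assume "dist h 0 < norm x - r"
    then have "norm (h *\<^sub>R (axis i 1 :: real^'a)) < norm x - r" by (simp add: dist_norm)
    then show "0 = f (x + h *\<^sub>R axis i 1)"
      using norm_triangle_ineq4[of "x + h *\<^sub>R axis i 1" "h *\<^sub>R axis i 1"] by (subst supp) auto
  qed (use x in auto)
  ultimately show ?thesis by (rule DERIV_unique)
qed

lemma LINT_by_parts:
  fixes f g :: "real^'n \<Rightarrow> real"
  assumes f: "has_partial i f f'" "continuous_on UNIV f" "continuous_on UNIV f'"
    and g: "has_partial i g g'" "continuous_on UNIV g" "continuous_on UNIV g'"
    and supp: "\<And>x. norm x > r \<Longrightarrow> f x = 0"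
  shows "integrable lborel (\<lambda>x. g x * f' x)" "integrable lborel (\<lambda>x. f x * g' x)"
    "(LINT x|lborel. g x * f' x) = - (LINT x|lborel. f x * g' x)"
proof -
  note supp' = has_partial_support[OF f(1) supp]
  show 1: "integrable lborel (\<lambda>x. g x * f' x)"
    by (rule integrable_compact_support[of _ r]) (use f g supp supp' in \<open>auto intro!: continuous_intros\<close>)
  show 2: "integrable lborel (\<lambda>x. f x * g' x)"
    by (rule integrable_compact_support[of _ r]) (use f g supp supp' in \<open>auto intro!: continuous_intros\<close>)
  have "(LINT x|lborel. f' x * g x + f x * g' x) = 0"
    by (rule LINT_partial_eq_0[OF has_partial_mult[OF f(1) g(1)], of r])
       (use f g supp in \<open>auto intro!: continuous_intros\<close>)
  then show "(LINT x|lborel. g x * f' x) = - (LINT x|lborel. f x * g' x)"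
    using 1 2 by (simp add: mult.commute)
qed

lemma LINT_divergence_by_parts:
  fixes F :: "real^'n \<Rightarrow> real^'n"
  assumes F: "\<And>j. has_partial j (\<lambda>x. F x $ j) (F' j)"
      "\<And>j. continuous_on UNIV (\<lambda>x. F x $ j)" "\<And>j. continuous_on UNIV (F' j)"
    and g: "\<And>j. has_partial j g (g' j)" "continuous_on UNIV g" "\<And>j. continuous_on UNIV (g' j)"
    and supp: "\<And>x. norm x > r \<Longrightarrow> F x = 0"
  shows "integrable lborel (\<lambda>x. g x * divergence F x)"
    "integrable lborel (\<lambda>x. \<Sum>j\<in>UNIV. F x $ j * g' j x)"
    "(LINT x|lborel. g x * divergence F x) = - (LINT x|lborel. (\<Sum>j\<in>UNIV. F x $ j * g' j x))"
proof -
  have div: "divergence F x = (\<Sum>j\<in>UNIV. F' j x)" for x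
    unfolding divergence_def using has_partial_imp_partial[OF F(1)] by simp
  have parts: "integrable lborel (\<lambda>x. g x * F' j x)" "integrable lborel (\<lambda>x. F x $ j * g' j x)"
    "(LINT x|lborel. g x * F' j x) = - (LINT x|lborel. F x $ j * g' j x)" for j
    using LINT_by_parts[OF F(1)[of j] F(2,3) g(1) g(2) g(3), of r] supp by auto
  show "integrable lborel (\<lambda>x. g x * divergence F x)"
    "integrable lborel (\<lambda>x. \<Sum>j\<in>UNIV. F x $ j * g' j x)"
    unfolding div sum_distrib_left by (intro Bochner_Integration.integrable_sum parts)+
  show "(LINT x|lborel. g x * divergence F x) = - (LINT x|lborel. (\<Sum>j\<in>UNIV. F x $ j * g' j x))"
    unfolding div sum_distrib_left using parts
    by (simp add: Bochner_Integration.integral_sum sum_negf)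
qed

section \<open>Local integrability of the kernel\<close>

lemma cball_in_sets_borel [measurable]: "cball a r \<in> sets borel"
  by (intro borel_closed closed_cball)

text \<open>The one-dimensional factor in the product bound for the kernel; |s|^(-a) is integrable
  at 0 for a < 1.\<close>

lemma nn_integral_abs_powr_finite:
  fixes r a :: real
  assumes "a < 1" "r \<ge> 0"
  shows "(\<integral>\<^sup>+s. ennreal (\<bar>s\<bar> powr (- a)) * indicator {-r..r} s \<partial>lborel) < \<infinity>"
proof -
  have 1: "(\<lambda>s. \<bar>s\<bar> powr (- a)) integrable_on {0..r}"
    using integrable_on_powr_from_0[of "-a" r] assms
    by (subst integrable_cong[where g = "\<lambda>s. s powr (-a)"]) auto
  have "(\<lambda>s. \<bar>- s\<bar> powr (- a)) integrable_on {-r..-0}"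
    using iffD2[OF Henstock_Kurzweil_Integration.integrable_reflect_real 1] .
  then have 2: "(\<lambda>s. \<bar>s\<bar> powr (- a)) integrable_on {-r..0}" by simp
  have "(\<lambda>s. \<bar>s\<bar> powr (- a)) integrable_on {-r..r}"
    using Henstock_Kurzweil_Integration.integrable_combine[OF _ _ 2 1] assms by auto
  then obtain y where "((\<lambda>s. \<bar>s\<bar> powr (- a)) has_integral y) {-r..r}" by blast
  from nn_integral_has_integral_lebesgue'[OF _ this] show ?thesis by simp
qed

lemma AE_lborel_inner_Basis_neq_0:
  "AE x::'a::euclidean_space in lborel. \<forall>b\<in>Basis. x \<bullet> b \<noteq> 0"
proof (rule AE_finite_allI[OF finite_Basis])
  fix b :: 'a assume b: "b \<in> Basis"
  have "{x. x \<bullet> b = 0} \<in> null_sets lebesgue"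
    using negligible_standard_hyperplane[OF b, of 0] by (simp add: negligible_iff_null_sets)
  then have "{x. x \<bullet> b = 0} \<in> null_sets lborel"
    by (subst (asm) null_sets_completion_iff) auto
  then show "AE x in lborel. x \<bullet> b \<noteq> 0"
    by (rule AE_I') auto
qed

text \<open>Since \<open>norm x\<close> dominates every coordinate, the integrand is at most the product of the
  one-dimensional integrable functions \<open>\<bar>x \<bullet> b\<bar> powr (- (d - 1) / d)\<close>.\<close>

lemma integrable_inverse_norm_power:
  fixes r :: real
  assumes r: "r \<ge> 0"
  shows "integrable lborel (\<lambda>x::'a::euclidean_space. indicator (cball 0 r) x * (1 / norm x ^ (DIM('a) - 1)))"
proof (rule integrableI_nonneg)
  let ?d = "DIM('a)" and ?h = "\<lambda>x::'a. indicator (cball 0 r) x * (1 / norm x ^ (DIM('a) - 1))"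
  define a where "a = (real ?d - 1) / real ?d"
  have a: "a < 1" "a \<ge> 0" unfolding a_def by (auto simp: DIM_positive Suc_leI)
  let ?k = "\<lambda>s::real. ennreal (\<bar>s\<bar> powr (- a)) * indicator {-r..r} s"
  \<comment> \<open>The coordinate hyperplanes are left out because \<open>0 powr (- a) = 0\<close>
    makes the product vanish there. Elsewhere the \<open>?d\<close> equal factors |x|^(-a) multiply
    to |x|^(1 - d), and each is at most the factor of its own coordinate.\<close>
  have "AE x in lborel. ennreal (?h x) \<le> (\<Prod>b\<in>Basis. ?k (x \<bullet> b))"
    using AE_lborel_inner_Basis_neq_0
  proof eventually_elim
    case (elim x)
    show ?case
    proof (cases "norm x \<le> r")
      case True
      obtain b :: 'a where "b \<in> Basis" using nonempty_Basis by blast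
      with elim have x: "norm x > 0" by auto
      have ind: "x \<bullet> b \<in> {-r..r}" if "b \<in> Basis" for b
        using Basis_le_norm[OF that, of x] True by auto
      have "norm x ^ (?d - 1) = (norm x powr a) ^ ?d"
        using x by (simp add: a_def powr_powr of_nat_diff Suc_leI DIM_positive flip: powr_realpow)
      then have "1 / norm x ^ (?d - 1) = (\<Prod>b\<in>(Basis::'a set). norm x powr (- a))"
        by (simp add: powr_minus field_simps)
      also have "\<dots> \<le> (\<Prod>b\<in>Basis. \<bar>x \<bullet> b\<bar> powr (- a))"
        by (intro prod_mono conjI powr_mono2') (use elim a Basis_le_norm in auto)
      finally have "ennreal (1 / norm x ^ (?d - 1)) \<le> (\<Prod>b\<in>Basis. ennreal (\<bar>x \<bullet> b\<bar> powr (- a)))"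
        by (subst prod_ennreal) (auto intro: ennreal_leI)
      also have "\<dots> = (\<Prod>b\<in>Basis. ?k (x \<bullet> b))"
        by (rule prod.cong) (use ind in auto)
      finally show ?thesis using True by simp
    qed (simp add: indicator_def)
  qed
  then have "(\<integral>\<^sup>+x. ennreal (?h x) \<partial>lborel) \<le> (\<integral>\<^sup>+x. (\<Prod>b\<in>Basis. ?k (x \<bullet> b)) \<partial>(lborel :: 'a measure))"
    by (rule nn_integral_mono_AE)
  also have "\<dots> = (\<Prod>b\<in>(Basis::'a set). \<integral>\<^sup>+s. ?k s \<partial>lborel)"
    by (rule nn_integral_lborel_prod) auto
  also have "\<dots> < \<infinity>"
    using nn_integral_abs_powr_finite[OF a(1) r]
    by (simp add: power_less_top_ennreal)
  finally show "(\<integral>\<^sup>+x. ennreal (?h x) \<partial>lborel) < \<infinity>" .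
  show "?h \<in> borel_measurable lborel" by measurable
qed auto

lemma G_measurable [measurable]: "(G :: real^'n \<Rightarrow> real) \<in> borel_measurable borel"
  unfolding G_def by measurable

text \<open>Both shapes of \<open>G\<close> are compared with the same singularity |x|^(1 - N). With
  s = |x|, the product |G| s^(N-1) equals s for N >= 3, while |ln s| <= s + 1/s gives at most s^2 +
  1 for N = 2; the factor \<open>r\<^sup>2 + r + 1\<close> covers both.\<close>

lemma G_bound:
  assumes "CARD('n) \<ge> 2" and "norm (x::real^'n) \<le> r"
  shows "\<bar>G x\<bar> \<le> (r\<^sup>2 + r + 1) * (1 / norm x ^ (CARD('n) - 1))"
proof (cases "x = 0")
  case True
  \<comment> \<open>At the origin both sides are 0, by \<open>ln 0 = 0\<close> and division by
    zero.\<close>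
  then show ?thesis using assms by (auto simp: G_def power_0_left)
next
  case False
  define s where "s = norm x"
  have s: "s > 0" "s \<le> r" using False assms by (auto simp: s_def)
  have le: "s\<^sup>2 + s + 1 \<le> r\<^sup>2 + r + 1" using s by (simp add: power_mono add_mono)
  have "\<bar>G x\<bar> * s ^ (CARD('n) - 1) \<le> s\<^sup>2 + s + 1"
  proof (cases "CARD('n) = 2")
    case True
    have "ln s \<le> s" using ln_le_minus_one[of s] s by simp
    moreover have "- ln s \<le> 1 / s"
      using ln_le_minus_one[of "1/s"] s by (simp add: ln_div)
    ultimately have "\<bar>ln s\<bar> \<le> s + 1 / s" using s by (simp add: abs_le_iff add_increasing add_increasing2)
    then have "\<bar>ln s\<bar> * s \<le> (s + 1 / s) * s" using s by (intro mult_right_mono) auto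
    also have "\<dots> \<le> s\<^sup>2 + s + 1" using s by (simp add: field_simps power2_eq_square)
    finally show ?thesis using True by (simp add: G_def s_def)
  next
    case False
    then have "CARD('n) - 1 = Suc (CARD('n) - 2)" using assms by simp
    then have "\<bar>G x\<bar> * s ^ (CARD('n) - 1) = s"
      using False s by (simp add: G_def s_def[symmetric])
    then show ?thesis using s by simp
  qed
  then have "\<bar>G x\<bar> \<le> (s\<^sup>2 + s + 1) * (1 / s ^ (CARD('n) - 1))"
    using s by (simp add: field_simps)
  also have "\<dots> \<le> (r\<^sup>2 + r + 1) * (1 / s ^ (CARD('n) - 1))"
    using le s by (intro mult_right_mono) auto
  finally show ?thesis by (simp add: s_def)
qed

lemma integrable_G_cball:
  assumes "CARD('n) \<ge> 2"
  shows "integrable lborel (\<lambda>x::real^'n. indicator (cball 0 r) x * \<bar>G x\<bar>)"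
proof (cases "r \<ge> 0")
  case True
  show ?thesis
  proof (rule Bochner_Integration.integrable_bound)
    show "integrable lborel (\<lambda>x::real^'n. (r\<^sup>2 + r + 1) *
        (indicator (cball 0 r) x * (1 / norm x ^ (DIM(real^'n) - 1))))"
      by (intro integrable_mult_right integrable_inverse_norm_power True)
    show "AE x::real^'n in lborel. norm (indicator (cball 0 r) x * \<bar>G x\<bar>)
       \<le> norm ((r\<^sup>2 + r + 1) * (indicator (cball 0 r) x * (1 / norm x ^ (DIM(real^'n) - 1))))"
      using G_bound[OF assms, of _ r] True by (auto intro!: AE_I2 simp: indicator_def)
    show "(\<lambda>x::real^'n. indicat_real (cball 0 r) x * \<bar>G x\<bar>) \<in> borel_measurable lborel"
      unfolding measurable_lborel2
      by (intro borel_measurable_times borel_measurable_abs G_measurable borel_measurable_indicator) auto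
  qed
qed (auto simp: indicator_def)

section \<open>Reflections and dilations as substitutions\<close>

lemma lborel_distr_reflect:
  fixes c :: "'a::euclidean_space"
  shows "distr lborel borel (\<lambda>x. c - x) = lborel"
  by (subst lborel_affine[of "-1" c]) (auto simp: density_1)

lemma LINT_reflect:
  fixes f :: "'a::euclidean_space \<Rightarrow> real"
  assumes [measurable]: "f \<in> borel_measurable borel"
  shows "(LINT x|lborel. f (c - x)) = (LINT x|lborel. f x)"
    "integrable lborel (\<lambda>x. f (c - x)) \<longleftrightarrow> integrable lborel f"
proof -
  have "(LINT x|lborel. f x) = (LINT x|distr lborel borel (\<lambda>x. c - x). f x)"
    by (simp add: lborel_distr_reflect)
  also have "\<dots> = (LINT x|lborel. f (c - x))" by (subst integral_distr) auto
  finally show "(LINT x|lborel. f (c - x)) = (LINT x|lborel. f x)" ..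
  have "integrable lborel f \<longleftrightarrow> integrable (distr lborel borel (\<lambda>x. c - x)) f"
    by (simp add: lborel_distr_reflect)
  also have "\<dots> \<longleftrightarrow> integrable lborel (\<lambda>x. f (c - x))" by (subst integrable_distr_eq) auto
  finally show "integrable lborel (\<lambda>x. f (c - x)) \<longleftrightarrow> integrable lborel f" ..
qed

lemma LINT_scale:
  fixes f :: "'a::euclidean_space \<Rightarrow> real"
  assumes [measurable]: "f \<in> borel_measurable borel" and c: "c > 0"
  shows "(LINT x|lborel. f (c *\<^sub>R x)) = (LINT x|lborel. f x) / c ^ DIM('a)"
proof -
  have "(LINT x|lborel. f x) =
      (LINT x|density (distr lborel borel (\<lambda>x. 0 + c *\<^sub>R x)) (\<lambda>_. \<bar>c\<bar> ^ DIM('a)). f x)"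
    using lborel_affine[of c "0::'a"] c by simp
  also have "\<dots> = c ^ DIM('a) * (LINT x|lborel. f (c *\<^sub>R x))"
    using c by (subst integral_density) (auto simp: integral_distr)
  finally show ?thesis using c by simp
qed

section \<open>The Newtonian bilinear form\<close>

text \<open>The class on which the form is continuous. With the radius \<open>r\<close> held fixed,
  the sup bound \<open>m\<close> is the only quantity that estimates have to track.\<close>

definition bounded_supported :: "real \<Rightarrow> (real^'n \<Rightarrow> real) \<Rightarrow> real \<Rightarrow> bool" where
  "bounded_supported r f m \<longleftrightarrow> f \<in> borel_measurable borel \<and>
     (\<forall>x. \<bar>f x\<bar> \<le> m) \<and> (\<forall>x. norm x > r \<longrightarrow> f x = 0)"

lemma bounded_supported_bound:
  assumes "bounded_supported r f m"
  shows "\<bar>f x\<bar> \<le> m * indicator (cball 0 r) x" "m \<ge> 0"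
  using assms abs_ge_zero[of "f x"] unfolding bounded_supported_def
  by (auto simp: indicator_def not_le intro: order_trans)

lemma bounded_supported_continuous:
  assumes "continuous_on UNIV f" and "\<And>x. norm x > r \<Longrightarrow> f x = 0"
  obtains m where "bounded_supported r f m"
proof -
  have "bounded (f ` cball 0 r)"
    by (intro compact_imp_bounded compact_continuous_image continuous_on_subset[OF assms(1)]) auto
  then obtain m where m: "\<And>x. norm x \<le> r \<Longrightarrow> \<bar>f x\<bar> \<le> m"
    unfolding bounded_iff by (metis image_eqI mem_cball_0 real_norm_def)
  have "\<bar>f x\<bar> \<le> max m 0" for x
    using m[of x] assms(2)[of x] by (cases "norm x \<le> r") auto
  then have "bounded_supported r f (max m 0)"
    unfolding bounded_supported_def using assms by (auto intro: borel_measurable_continuous_onI)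
  then show ?thesis ..
qed

lemma bounded_supported_add:
  "bounded_supported r f m \<Longrightarrow> bounded_supported r g m' \<Longrightarrow> bounded_supported r (\<lambda>x. f x + g x) (m + m')"
  unfolding bounded_supported_def by (auto intro!: order_trans[OF abs_triangle_ineq] add_mono)

lemma bounded_supported_cmult:
  "bounded_supported r f m \<Longrightarrow> bounded_supported r (\<lambda>x. c * f x) (\<bar>c\<bar> * m)"
  unfolding bounded_supported_def by (auto simp: abs_mult mult_left_mono)

lemma bounded_supported_integrable:
  assumes "bounded_supported r f m"
  shows "integrable lborel f"
proof (rule Bochner_Integration.integrable_bound)
  show "integrable lborel (\<lambda>x::real^'a. m * indicator (cball 0 r) x)"
    by (intro integrable_mult_right integrable_real_indicator emeasure_lborel_cball_finite) auto
  show "AE x in lborel. norm (f x) \<le> norm (m * indicat_real (cball 0 r) x)"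
    using bounded_supported_bound[OF assms] by (auto intro!: AE_I2 simp: abs_mult)
qed (use assms in \<open>auto simp: bounded_supported_def\<close>)

text \<open>The integral of \<open>potential\<close>, detached from time so that it also applies to
  dilated densities and to their derivatives.\<close>

definition newton :: "(real^'n \<Rightarrow> real) \<Rightarrow> real^'n \<Rightarrow> real" where
  "newton g x = (LINT y|lborel. G (x - y) * g y)"

definition newton_form :: "(real^'n \<Rightarrow> real) \<Rightarrow> (real^'n \<Rightarrow> real) \<Rightarrow> real" where
  "newton_form f g = (LINT x|lborel. f x * newton g x)"

text \<open>The L1 norm of the kernel on a ball. The \<open>itself\<close> argument supplies the
  dimension, which occurs only in a type.\<close>

definition G_mass :: "'n::finite itself \<Rightarrow> real \<Rightarrow> real" where
  "G_mass _ r = (LINT z|lborel. indicator (cball (0::real^'n) r) z * \<bar>G z\<bar>)"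

lemma G_mass_nonneg: "G_mass TYPE('n::finite) r \<ge> 0"
  unfolding G_mass_def by (rule Bochner_Integration.integral_nonneg) auto

lemma G_diff_commute: "G (x - y) = G (y - x)"
  unfolding G_def by (simp add: norm_minus_commute)

text \<open>For y in the support of \<open>g\<close> and |x| <= r', the difference x - y stays in
  the ball of radius r' + r. The substitution y -> x - y then leaves the integral of |G| over that
  ball.\<close>

lemma newton_integrand:
  fixes g :: "real^'n \<Rightarrow> real"
  assumes card: "CARD('n) \<ge> 2" and g: "bounded_supported r g m"
  shows "integrable lborel (\<lambda>y. G (x - y) * g y)"
    and "norm x \<le> r' \<Longrightarrow> (LINT y|lborel. \<bar>G (x - y) * g y\<bar>) \<le> m * G_mass TYPE('n) (r' + r)"
proof -
  let ?w = "\<lambda>s (z::real^'n). indicator (cball 0 s) z * \<bar>G z\<bar>"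
  have [measurable]: "g \<in> borel_measurable borel" using g by (simp add: bounded_supported_def)
  have w [measurable]: "?w s \<in> borel_measurable borel" for s
    by (intro borel_measurable_times borel_measurable_abs G_measurable borel_measurable_indicator) auto
  have m: "m \<ge> 0" by (rule bounded_supported_bound[OF g])
  have int: "integrable lborel (\<lambda>y. m * ?w s (x - y))" for s
    using LINT_reflect(2)[OF w, of s x] integrable_G_cball[OF card, of s] by auto
  have le: "\<bar>G (x - y) * g y\<bar> \<le> m * ?w (s + r) (x - y)" if "norm x \<le> s" for y s
  proof (cases "norm y \<le> r")
    case True
    then have "norm (x - y) \<le> s + r" using that norm_triangle_ineq4[of x y] by simp
    moreover have "\<bar>G (x - y)\<bar> * \<bar>g y\<bar> \<le> \<bar>G (x - y)\<bar> * m"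
      using g by (intro mult_left_mono) (auto simp: bounded_supported_def)
    ultimately show ?thesis by (simp add: abs_mult mult.commute)
  next
    case False
    then have "g y = 0" using g by (auto simp: bounded_supported_def)
    then show ?thesis using m by simp
  qed
  show 1: "integrable lborel (\<lambda>y. G (x - y) * g y)"
  proof (rule Bochner_Integration.integrable_bound[OF int[of "norm x + r"]])
    show "AE y in lborel. norm (G (x - y) * g y) \<le> norm (m * ?w (norm x + r) (x - y))"
      using le[of "norm x"] by (intro AE_I2) (use m in \<open>auto simp: abs_mult\<close>)
  qed measurable
  assume "norm x \<le> r'"
  then have "(LINT y|lborel. \<bar>G (x - y) * g y\<bar>) \<le> (LINT y|lborel. m * ?w (r' + r) (x - y))"
    using 1 int le by (intro integral_mono) auto
  also have "\<dots> = m * G_mass TYPE('n) (r' + r)"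
    using LINT_reflect(1)[OF w, of "r' + r" x] by (simp add: G_mass_def)
  finally show "(LINT y|lborel. \<bar>G (x - y) * g y\<bar>) \<le> m * G_mass TYPE('n) (r' + r)" .
qed

lemma newton_bound:
  fixes g :: "real^'n \<Rightarrow> real"
  assumes card: "CARD('n) \<ge> 2" and "bounded_supported r g m" "norm x \<le> r'"
  shows "\<bar>newton g x\<bar> \<le> m * G_mass TYPE('n) (r' + r)"
  unfolding newton_def by (rule order_trans[OF integral_abs_bound newton_integrand(2)[OF assms]])

lemma newton_measurable:
  fixes g :: "real^'n \<Rightarrow> real"
  assumes [measurable]: "g \<in> borel_measurable borel"
  shows "newton g \<in> borel_measurable borel"
proof -
  have "(\<lambda>x. LINT y|lborel. G (x - y) * g y) \<in> borel_measurable lborel" by measurable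
  then show ?thesis unfolding newton_def by simp
qed

lemma newton_form_integrable:
  fixes f g :: "real^'n \<Rightarrow> real"
  assumes card: "CARD('n) \<ge> 2" and f: "bounded_supported r f m" and g: "bounded_supported r g m'"
  shows "bounded_supported r (\<lambda>x. f x * newton g x) (m * (m' * G_mass TYPE('n) (r + r)))"
  unfolding bounded_supported_def
proof (intro conjI allI impI)
  show "(\<lambda>x. f x * newton g x) \<in> borel_measurable borel"
    using f g newton_measurable[of g] by (auto simp: bounded_supported_def)
  show "f x * newton g x = 0" if "norm x > r" for x
    using f that by (auto simp: bounded_supported_def)
  show "\<bar>f x * newton g x\<bar> \<le> m * (m' * G_mass TYPE('n) (r + r))" for x
  proof (cases "norm x \<le> r")
    case True
    have "\<bar>f x\<bar> \<le> m" using f by (auto simp: bounded_supported_def)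
    then show ?thesis
      unfolding abs_mult by (intro mult_mono newton_bound[OF card g True] bounded_supported_bound[OF f]) auto
  next
    case False
    then have "f x = 0" using f by (auto simp: bounded_supported_def)
    then show ?thesis
      using bounded_supported_bound(2)[OF f] bounded_supported_bound(2)[OF g] G_mass_nonneg[of "r + r", where 'n = 'n] by simp
  qed
qed

text \<open>Continuity of the form in the sup norm: beyond \<open>m * m'\<close> the bound depends
  on \<open>r\<close> alone, so a uniformly small perturbation changes the form little.\<close>

lemma newton_form_bound:
  fixes f g :: "real^'n \<Rightarrow> real"
  assumes card: "CARD('n) \<ge> 2" and "bounded_supported r f m" and "bounded_supported r g m'"
  shows "\<bar>newton_form f g\<bar> \<le> m * m' * (G_mass TYPE('n) (r + r) * measure lborel (cball (0::real^'n) r))"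
proof -
  let ?c = "m * (m' * G_mass TYPE('n) (r + r))"
  note b = newton_form_integrable[OF assms]
  have "\<bar>newton_form f g\<bar> \<le> (LINT x|lborel. \<bar>f x * newton g x\<bar>)"
    unfolding newton_form_def by (rule integral_abs_bound)
  also have "\<dots> \<le> (LINT x|lborel. ?c * indicator (cball (0::real^'n) r) x)"
    by (intro integral_mono integrable_abs bounded_supported_integrable[OF b] bounded_supported_bound(1)[OF b]
        integrable_mult_right integrable_real_indicator emeasure_lborel_cball_finite) auto
  also have "\<dots> = ?c * measure lborel (cball (0::real^'n) r)" by simp
  finally show ?thesis by (simp add: mult_ac)
qed

text \<open>Fubini and the evenness of \<open>G\<close>. Absolute integrability on the product space
  comes from the uniform bound on the inner integral in \<open>newton_integrand\<close>.\<close>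

lemma newton_form_commute:
  fixes f g :: "real^'n \<Rightarrow> real"
  assumes card: "CARD('n) \<ge> 2" and f: "bounded_supported r f m" and g: "bounded_supported r g m'"
  shows "newton_form f g = newton_form g f"
proof -
  have [measurable]: "f \<in> borel_measurable borel" "g \<in> borel_measurable borel"
    using f g by (auto simp: bounded_supported_def)
  have g': "bounded_supported r (\<lambda>x. \<bar>g x\<bar>) m'" and f': "bounded_supported r (\<lambda>x. \<bar>f x\<bar>) m"
    using f g by (auto simp: bounded_supported_def)
  have "integrable (lborel \<Otimes>\<^sub>M lborel) (\<lambda>(x, y). f x * (G (x - y) * g y))"
  proof (rule lborel_pair.Fubini_integrable)
    show "(\<lambda>(x, y). f x * (G (x - y) * g y)) \<in> borel_measurable (lborel \<Otimes>\<^sub>M lborel)" by measurable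
    have "integrable lborel (\<lambda>x. \<bar>f x\<bar> * (LINT y|lborel. \<bar>G (x - y) * g y\<bar>))"
    proof (rule Bochner_Integration.integrable_bound)
      show "integrable lborel (\<lambda>x. \<bar>f x\<bar> * (m' * G_mass TYPE('n) (r + r)))"
        by (intro integrable_mult_left bounded_supported_integrable[OF f'])
      show "AE x in lborel. norm (\<bar>f x\<bar> * (LINT y|lborel. \<bar>G (x - y) * g y\<bar>))
          \<le> norm (\<bar>f x\<bar> * (m' * G_mass TYPE('n) (r + r)))"
      proof (rule AE_I2)
        fix x
        have "\<bar>LINT y|lborel. \<bar>G (x - y) * g y\<bar>\<bar> \<le> \<bar>m' * G_mass TYPE('n) (r + r)\<bar>" if "norm x \<le> r"
          using newton_integrand(2)[OF card g that] by (simp add: Bochner_Integration.integral_nonneg)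
        moreover have "f x = 0" if "\<not> norm x \<le> r" using f that by (auto simp: bounded_supported_def)
        ultimately show "norm (\<bar>f x\<bar> * (LINT y|lborel. \<bar>G (x - y) * g y\<bar>))
            \<le> norm (\<bar>f x\<bar> * (m' * G_mass TYPE('n) (r + r)))"
          by (cases "norm x \<le> r") (auto simp: abs_mult intro!: mult_left_mono)
      qed
    qed measurable
    then show "integrable lborel (\<lambda>x. LINT y|lborel. norm (case (x, y) of (x, y) \<Rightarrow> f x * (G (x - y) * g y)))"
      by (simp add: abs_mult)
    show "AE x in lborel. integrable lborel (\<lambda>y. case (x, y) of (x, y) \<Rightarrow> f x * (G (x - y) * g y))"
      using newton_integrand(1)[OF card g] by simp
  qed
  from lborel_pair.Fubini_integral[OF this]
  have *: "newton_form f g = (LINT y|lborel. (LINT x|lborel. f x * (G (x - y) * g y)))"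
    unfolding newton_form_def newton_def by simp
  have eq: "f x * (G (x - y) * g y) = g y * (G (y - x) * f x)" for x y
    by (simp add: G_diff_commute[of x y])
  have "(LINT y|lborel. (LINT x|lborel. f x * (G (x - y) * g y))) = newton_form g f"
    unfolding newton_form_def newton_def eq integral_mult_right_zero ..
  with * show ?thesis by simp
qed

lemma newton_form_add_left:
  fixes f g h :: "real^'n \<Rightarrow> real"
  assumes card: "CARD('n) \<ge> 2" and "bounded_supported r f m" "bounded_supported r h m''" and "bounded_supported r g m'"
  shows "newton_form (\<lambda>x. f x + h x) g = newton_form f g + newton_form h g"
  unfolding newton_form_def
  using bounded_supported_integrable[OF newton_form_integrable[OF assms(1,2,4)]]
    bounded_supported_integrable[OF newton_form_integrable[OF assms(1,3,4)]]
  by (simp add: distrib_right)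

lemma newton_form_cmult_left:
  "newton_form (\<lambda>x. c * f x) g = c * newton_form f g"
  unfolding newton_form_def by (simp add: mult.assoc)

section \<open>Differentiation and scaling of the bilinear form\<close>

text \<open>The sup norm bound of the form calls for a first-order expansion uniform in x, whereas
  the derivative is given pointwise. Uniform continuity of \<open>f'\<close> on the compact product,
  with the mean value inequality for \<open>f s x - s * f' t x\<close>, supplies it.\<close>

lemma uniform_difference_quotient:
  fixes f :: "real \<Rightarrow> 'a::metric_space \<Rightarrow> real"
  assumes t: "t \<in> {a..b}" and K: "compact K"
    and der: "\<And>s x. s \<in> {a..b} \<Longrightarrow> ((\<lambda>s. f s x) has_real_derivative f' s x) (at s within {a..b})"
    and cont: "continuous_on ({a..b} \<times> K) (\<lambda>(s, x). f' s x)"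
    and e: "e > 0"
  shows "\<exists>d>0. \<forall>s\<in>{a..b}. \<bar>s - t\<bar> < d \<longrightarrow> (\<forall>x\<in>K. \<bar>f s x - f t x - (s - t) * f' t x\<bar> \<le> e * \<bar>s - t\<bar>)"
proof -
  have "uniformly_continuous_on ({a..b} \<times> K) (\<lambda>(s, x). f' s x)"
    using cont K by (intro compact_uniformly_continuous compact_Times) auto
  then obtain d where d: "d > 0" and
    close: "\<And>s x s' x'. s \<in> {a..b} \<Longrightarrow> s' \<in> {a..b} \<Longrightarrow> x \<in> K \<Longrightarrow> x' \<in> K \<Longrightarrow>
      dist (s', x') (s, x) < d \<Longrightarrow> dist (f' s' x') (f' s x) < e"
    using e unfolding uniformly_continuous_on_def by (fastforce simp: Ball_def)
  have "\<bar>f s x - f t x - (s - t) * f' t x\<bar> \<le> e * \<bar>s - t\<bar>"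
    if s: "s \<in> {a..b}" "\<bar>s - t\<bar> < d" and x: "x \<in> K" for s x
  proof -
    let ?I = "{min s t..max s t}"
    have "norm ((f s x - s * f' t x) - (f t x - t * f' t x)) \<le> e * norm (s - t)"
    proof (rule field_differentiable_bound[of ?I "\<lambda>s. f s x - s * f' t x" "\<lambda>s. f' s x - f' t x"])
      fix z assume z: "z \<in> ?I"
      then have zI: "z \<in> {a..b}" using s t by auto
      show "((\<lambda>s. f s x - s * f' t x) has_field_derivative f' z x - f' t x) (at z within ?I)"
        using has_field_derivative_subset[OF der[OF zI], of ?I] s t
        by (auto intro!: derivative_eq_intros)
      have "dist (z, x) (t, x) < d" using z s by (auto simp: dist_Pair_Pair dist_real_def)
      from close[OF t zI x x this] show "norm (f' z x - f' t x) \<le> e"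
        by (simp add: dist_real_def)
    qed auto
    then show ?thesis by (simp add: algebra_simps)
  qed
  with d show ?thesis by blast
qed

text \<open>Product rule for a symmetric bounded bilinear form along a curve. Only \<open>f\<close>
  is differentiated, so the singularity of \<open>G\<close> never enters.\<close>

lemma has_real_derivative_newton_form:
  fixes f :: "real \<Rightarrow> real^'n \<Rightarrow> real"
  assumes card: "CARD('n) \<ge> 2" and t: "a < b" "t \<in> {a..b}"
    and der: "\<And>s x. s \<in> {a..b} \<Longrightarrow> ((\<lambda>s. f s x) has_real_derivative f' s x) (at s within {a..b})"
    and cont: "\<And>s. s \<in> {a..b} \<Longrightarrow> continuous_on UNIV (f s)"
    and cont': "continuous_on ({a..b} \<times> UNIV) (\<lambda>(s, x). f' s x)"
    and supp: "\<And>s x. s \<in> {a..b} \<Longrightarrow> norm x > r \<Longrightarrow> f s x = 0"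
    and supp': "\<And>x. norm x > r \<Longrightarrow> f' t x = 0"
  shows "((\<lambda>s. newton_form (f s) (f s)) has_real_derivative 2 * newton_form (f' t) (f t)) (at t within {a..b})"
proof -
  define C where "C = G_mass TYPE('n) (r + r) * measure lborel (cball (0::real^'n) r)"
  have C: "C \<ge> 0" unfolding C_def by (intro mult_nonneg_nonneg G_mass_nonneg measure_nonneg)
  define q where "q = (\<lambda>s x. f s x - f t x - (s - t) * f' t x)"
  obtain m0 where m0: "bounded_supported r (f t) m0"
    by (rule bounded_supported_continuous[OF cont[OF t(2)] supp[OF t(2)]])
  obtain m1 where m1: "bounded_supported r (f' t) m1"
    by (rule bounded_supported_continuous[OF continuous_on_section[OF cont' t(2)] supp'])
  have q_bound: "bounded_supported r (q s) k" if "s \<in> {a..b}" "\<forall>x\<in>cball 0 r. \<bar>q s x\<bar> \<le> k" "k \<ge> 0" for s k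
    unfolding bounded_supported_def
  proof (intro conjI allI impI)
    show "q s \<in> borel_measurable borel"
      unfolding q_def
      by (intro borel_measurable_continuous_onI continuous_intros cont continuous_on_section[OF cont'] t that)
    show z: "q s x = 0" if "norm x > r" for x
      using that \<open>s \<in> _\<close> supp supp' t unfolding q_def by auto
    show "\<bar>q s x\<bar> \<le> k" for x using that z[of x] by (cases "norm x \<le> r") auto
  qed
  have f_split: "f s = (\<lambda>x. f t x + ((s - t) * f' t x + q s x))" for s
    by (auto simp: q_def)
  \<comment> \<open>With \<open>f s = f t + h\<close> and \<open>h = (s - t) f' t + q s\<close>,
    bilinearity and symmetry leave exactly 2 B(q, f t) + B(h, h) as the remainder.\<close>
  have expand: "\<bar>newton_form (f s) (f s) - newton_form (f t) (f t) - (s - t) * (2 * newton_form (f' t) (f t))\<bar>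
      \<le> C * (2 * (k * m0) + (\<bar>s - t\<bar> * m1 + k) * (\<bar>s - t\<bar> * m1 + k))"
    if s: "s \<in> {a..b}" and k: "bounded_supported r (q s) k" for s k
  proof -
    define h where "h = (\<lambda>x. (s - t) * f' t x + q s x)"
    have fs: "f s = (\<lambda>x. f t x + h x)" unfolding h_def by (rule f_split)
    note sf = bounded_supported_cmult[OF m1, of "s - t"]
    have h: "bounded_supported r h (\<bar>s - t\<bar> * m1 + k)"
      unfolding h_def by (rule bounded_supported_add[OF sf k])
    note fh = bounded_supported_add[OF m0 h]
    have "newton_form (f s) (f s) = newton_form (f t) (f s) + newton_form h (f s)"
      using newton_form_add_left[OF card m0 h] fh unfolding fs by blast
    also have "newton_form (f t) (f s) = newton_form (f t) (f t) + newton_form h (f t)"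
      using newton_form_add_left[OF card m0 h m0] newton_form_commute[OF card m0 fh]
      unfolding fs by simp
    also have "newton_form h (f s) = newton_form h (f t) + newton_form h h"
      using newton_form_add_left[OF card m0 h h] newton_form_commute[OF card h fh]
        newton_form_commute[OF card h m0]
      unfolding fs by simp
    also have "newton_form h (f t) = (s - t) * newton_form (f' t) (f t) + newton_form (q s) (f t)"
      unfolding h_def using newton_form_add_left[OF card sf k m0] newton_form_cmult_left by simp
    finally have "newton_form (f s) (f s) - newton_form (f t) (f t) - (s - t) * (2 * newton_form (f' t) (f t))
      = 2 * newton_form (q s) (f t) + newton_form h h" by simp
    moreover have "\<bar>newton_form (q s) (f t)\<bar> \<le> C * (k * m0)"
      using newton_form_bound[OF card k m0] by (simp add: C_def mult_ac)
    moreover have "\<bar>newton_form h h\<bar> \<le> C * ((\<bar>s - t\<bar> * m1 + k) * (\<bar>s - t\<bar> * m1 + k))"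
      using newton_form_bound[OF card h h] by (simp add: C_def mult_ac)
    ultimately show ?thesis by (simp add: distrib_left)
  qed
  have m: "m0 \<ge> 0" "m1 \<ge> 0" using bounded_supported_bound(2)[OF m0] bounded_supported_bound(2)[OF m1] .
  show ?thesis
    unfolding has_field_derivative_def has_derivative_within_alt
  proof (intro conjI allI impI)
    show "bounded_linear ((*) (2 * newton_form (f' t) (f t)))" by (rule bounded_linear_mult_right)
    fix e :: real assume e: "e > 0"
    \<comment> \<open>The allowance \<open>e\<close> is split in halves: \<eta> makes the term
      linear in \<open>q\<close> at most (e/2) |s - t|, and \<open>d'\<close> below does the same
      for the quadratic term. The added ones keep the denominators positive.\<close>
    define A where "A = C * (2 * m0 + 1) + 1"
    have A: "A \<ge> 1" using C m by (simp add: A_def)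
    define \<eta> where "\<eta> = min 1 (e / (2 * A))"
    have \<eta>: "\<eta> > 0" "\<eta> \<le> 1" "A * \<eta> \<le> e / 2"
      using e A by (auto simp: \<eta>_def field_simps min_def split: if_splits)
    have "\<exists>d>0. \<forall>s\<in>{a..b}. \<bar>s - t\<bar> < d \<longrightarrow> (\<forall>x\<in>cball 0 r. \<bar>q s x\<bar> \<le> \<eta> * \<bar>s - t\<bar>)"
      unfolding q_def
      by (rule uniform_difference_quotient[OF t(2) compact_cball der continuous_on_subset[OF cont'] \<eta>(1)])
         auto
    then obtain d where d: "d > 0" and small: "\<And>s. s \<in> {a..b} \<Longrightarrow> \<bar>s - t\<bar> < d \<Longrightarrow>
        \<forall>x\<in>cball 0 r. \<bar>q s x\<bar> \<le> \<eta> * \<bar>s - t\<bar>"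
      by blast
    define d' where "d' = min d (e / (2 * ((C + 1) * (m1 + 1) * (m1 + 1))))"
    have pos: "(C + 1) * (m1 + 1) * (m1 + 1) > 0" using C m by simp
    have d': "d' > 0" using d e pos by (simp add: d'_def)
    have "\<bar>newton_form (f s) (f s) - newton_form (f t) (f t) - (s - t) * (2 * newton_form (f' t) (f t))\<bar>
        \<le> e * \<bar>s - t\<bar>" if s: "s \<in> {a..b}" "\<bar>s - t\<bar> < d'" for s
    proof -
      let ?u = "\<bar>s - t\<bar>"
      have "\<bar>newton_form (f s) (f s) - newton_form (f t) (f t) - (s - t) * (2 * newton_form (f' t) (f t))\<bar>
          \<le> C * (2 * (\<eta> * ?u * m0) + (?u * m1 + \<eta> * ?u) * (?u * m1 + \<eta> * ?u))"
        using s by (intro expand q_bound small) (use \<eta> in \<open>auto simp: d'_def\<close>)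
      also have "\<dots> \<le> C * (2 * (\<eta> * ?u * m0) + (?u * m1 + ?u) * (?u * m1 + ?u))"
        using \<eta> m by (intro mult_left_mono add_left_mono mult_mono C)
          (auto simp: mult_left_le_one_le intro!: add_nonneg_nonneg mult_nonneg_nonneg)
      also have "\<dots> = (C * (2 * m0)) * \<eta> * ?u + C * (m1 + 1) * (m1 + 1) * ?u * ?u"
        by (simp add: algebra_simps)
      also have "\<dots> \<le> A * \<eta> * ?u + (C + 1) * (m1 + 1) * (m1 + 1) * ?u * ?u"
        using C m \<eta> by (intro add_mono mult_right_mono) (auto simp: A_def algebra_simps)
      also have "\<dots> \<le> (e / 2) * ?u + (e / 2) * ?u"
      proof (intro add_mono mult_right_mono)
        have "?u \<le> e / (2 * ((C + 1) * (m1 + 1) * (m1 + 1)))" using s by (simp add: d'_def)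
        then show "(C + 1) * (m1 + 1) * (m1 + 1) * ?u \<le> e / 2"
          using pos by (simp add: field_simps)
      qed (use \<eta> in auto)
      finally show ?thesis by simp
    qed
    then show "\<exists>d>0. \<forall>y\<in>{a..b}. norm (y - t) < d \<longrightarrow>
        norm (newton_form (f y) (f y) - newton_form (f t) (f t) - 2 * newton_form (f' t) (f t) * (y - t))
          \<le> e * norm (y - t)"
      using d' by (auto simp: mult.commute intro!: exI[of _ d'])
  qed
qed

section \<open>Behaviour of the kernel and of the form under dilations\<close>

lemma G_scale:
  assumes "CARD('n) \<ge> 3" "c > 0"
  shows "G ((1 / c) *\<^sub>R z :: real^'n) = c ^ (CARD('n) - 2) * G z"
  using assms by (auto simp: G_def power_divide field_simps)

text \<open>The logarithm is homogeneous only up to an additive constant. The origin is excluded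
  because \<open>ln 0 = 0\<close> breaks the law there.\<close>

lemma G_scale_2:
  assumes "CARD('n) = 2" "c > 0" "z \<noteq> 0"
  shows "G ((1 / c) *\<^sub>R z :: real^'n) = G z - ln c"
  using assms by (auto simp: G_def ln_div)

lemma newton_scale_aux:
  fixes g :: "real^'n \<Rightarrow> real"
  assumes [measurable]: "g \<in> borel_measurable borel" and c: "c > 0"
  shows "newton (\<lambda>y. g (c *\<^sub>R y)) x =
    (LINT w|lborel. G ((1 / c) *\<^sub>R (c *\<^sub>R x - w)) * g w) / c ^ CARD('n)"
proof -
  have "newton (\<lambda>y. g (c *\<^sub>R y)) x =
      (LINT y|lborel. G ((1 / c) *\<^sub>R (c *\<^sub>R x - c *\<^sub>R y)) * g (c *\<^sub>R y))"
    unfolding newton_def using c by (simp add: scaleR_diff_right)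
  also have "\<dots> = (LINT w|lborel. G ((1 / c) *\<^sub>R (c *\<^sub>R x - w)) * g w) / c ^ CARD('n)"
    by (subst LINT_scale[where f = "\<lambda>w. G ((1 / c) *\<^sub>R (c *\<^sub>R x - w)) * g w"]) (use c in auto)
  finally show ?thesis .
qed

text \<open>The potential of the dilated function gains c^(N-2) from the kernel and c^(-N) from the
  inner substitution, hence c^(-2); the outer substitution contributes another c^(-N).\<close>

lemma newton_form_scale:
  fixes g :: "real^'n \<Rightarrow> real"
  assumes N: "CARD('n) \<ge> 3" and [measurable]: "g \<in> borel_measurable borel" and c: "c > 0"
  shows "newton_form (\<lambda>x. g (c *\<^sub>R x)) (\<lambda>x. g (c *\<^sub>R x)) = newton_form g g * inverse c ^ (CARD('n) + 2)"
proof -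
  obtain k where k: "CARD('n) = k + 2" using N by (intro that[of "CARD('n) - 2"]) simp
  note [measurable] = newton_measurable
  have nw: "newton (\<lambda>y. g (c *\<^sub>R y)) x = newton g (c *\<^sub>R x) / c\<^sup>2" for x
  proof -
    have "newton (\<lambda>y. g (c *\<^sub>R y)) x = c ^ k * newton g (c *\<^sub>R x) / c ^ (k + 2)"
      unfolding newton_scale_aux[OF assms(2) c] unfolding G_scale[OF N c]
      unfolding newton_def by (simp add: mult.assoc k del: power_add power_Suc)
    also have "\<dots> = newton g (c *\<^sub>R x) / c\<^sup>2" using c by (simp add: power_add power2_eq_square)
    finally show ?thesis .
  qed
  have "newton_form (\<lambda>x. g (c *\<^sub>R x)) (\<lambda>x. g (c *\<^sub>R x)) = (LINT x|lborel. g (c *\<^sub>R x) * newton g (c *\<^sub>R x)) / c\<^sup>2"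
    unfolding newton_form_def nw by simp
  also have "(LINT x|lborel. g (c *\<^sub>R x) * newton g (c *\<^sub>R x)) = newton_form g g / c ^ CARD('n)"
    unfolding newton_form_def
    by (subst LINT_scale[where f = "\<lambda>x. g x * newton g x"]) (use c in auto)
  finally show ?thesis using c by (simp add: power_add power2_eq_square field_simps)
qed

text \<open>The constant \<open>ln c\<close> in the kernel is integrated against \<open>g\<close>
  twice and becomes \<open>ln c\<close> times the squared mass. This is the source of the term M^2 /
  2 in the planar virial identity.\<close>

lemma newton_form_scale_2:
  fixes g :: "real^'n \<Rightarrow> real"
  assumes N: "CARD('n) = 2" and g: "bounded_supported r g m" and c: "c > 0"
  shows "newton_form (\<lambda>x. g (c *\<^sub>R x)) (\<lambda>x. g (c *\<^sub>R x))
    = (newton_form g g - ln c * (LINT x|lborel. g x)\<^sup>2) * inverse c ^ 4"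
proof -
  have gm [measurable]: "g \<in> borel_measurable borel" using g by (simp add: bounded_supported_def)
  note [measurable] = newton_measurable
  have card: "CARD('n) \<ge> 2" using N by simp
  let ?M = "LINT x|lborel. g x"
  have int: "integrable lborel g" by (rule bounded_supported_integrable[OF g])
  have nw: "newton (\<lambda>y. g (c *\<^sub>R y)) x = (newton g (c *\<^sub>R x) - ln c * ?M) / c\<^sup>2" for x
  proof -
    have "(LINT w|lborel. G ((1 / c) *\<^sub>R (c *\<^sub>R x - w)) * g w) =
        (LINT w|lborel. G (c *\<^sub>R x - w) * g w - ln c * g w)"
    proof (rule integral_cong_AE)
      show "AE w in lborel. G ((1 / c) *\<^sub>R (c *\<^sub>R x - w)) * g w = G (c *\<^sub>R x - w) * g w - ln c * g w"
        \<comment> \<open>The scaling law of the logarithm fails only at w = c x, a null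
          set.\<close>
        using AE_lborel_singleton[of "c *\<^sub>R x"]
      proof eventually_elim
        case (elim w)
        then show ?case using G_scale_2[OF N c, of "c *\<^sub>R x - w"] by (simp add: left_diff_distrib)
      qed
    qed measurable
    also have "\<dots> = newton g (c *\<^sub>R x) - ln c * ?M"
      unfolding newton_def using newton_integrand(1)[OF card g] int by simp
    finally show ?thesis unfolding newton_scale_aux[OF gm c] by (simp add: N)
  qed
  have "newton_form (\<lambda>x. g (c *\<^sub>R x)) (\<lambda>x. g (c *\<^sub>R x))
      = (LINT x|lborel. g (c *\<^sub>R x) * (newton g (c *\<^sub>R x) - ln c * ?M)) / c\<^sup>2"
    unfolding newton_form_def nw by simp
  also have "(LINT x|lborel. g (c *\<^sub>R x) * (newton g (c *\<^sub>R x) - ln c * ?M))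
      = (LINT x|lborel. g x * (newton g x - ln c * ?M)) / c\<^sup>2"
    by (subst LINT_scale[where f = "\<lambda>x. g x * (newton g x - ln c * ?M)"]) (use c in \<open>auto simp: N\<close>)
  also have "(LINT x|lborel. g x * (newton g x - ln c * ?M)) = newton_form g g - ln c * ?M\<^sup>2"
    unfolding newton_form_def using bounded_supported_integrable[OF newton_form_integrable[OF card g g]] int
    by (simp add: right_diff_distrib power2_eq_square)
  finally show ?thesis using c by (simp add: power2_eq_square power4_eq_xxxx field_simps)
qed

text \<open>Continuity of derivatives is available for one fixed direction at a time. This expansion
  transfers it to directions that move with the point, such as x itself.\<close>

lemma bounded_linear_axis_expansion:
  fixes f :: "real^'n \<Rightarrow> real"
  assumes "bounded_linear f"
  shows "f v = (\<Sum>i\<in>UNIV. v $ i * f (axis i 1))"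
proof -
  interpret bounded_linear f by fact
  have "f v = f (\<Sum>i\<in>UNIV. v $ i *\<^sub>R axis i 1)"
    using basis_expansion[of v] by (simp add: scalar_mult_eq_scaleR)
  then show ?thesis by (simp add: sum scaleR)
qed

lemma scaling_derivative_newton_form:
  fixes g :: "real^'n \<Rightarrow> real"
  assumes card: "CARD('n) \<ge> 2" and der: "\<And>x. (g has_derivative g' x) (at x)"
    and cont: "\<And>v. continuous_on UNIV (\<lambda>x. g' x v)"
    and supp: "\<And>x. norm x > r \<Longrightarrow> g x = 0"
  shows "((\<lambda>s. newton_form (\<lambda>x. g (s *\<^sub>R x)) (\<lambda>x. g (s *\<^sub>R x))) has_real_derivative
      2 * newton_form (\<lambda>x. g' x x) g) (at 1)"
proof -
  have expand: "g' x v = (\<Sum>i\<in>UNIV. v $ i * g' x (axis i 1))" for x v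
    by (rule bounded_linear_axis_expansion[OF has_derivative_bounded_linear[OF der]])
  have supp': "g' x v = 0" if "norm x > r" for x v
    using has_partial_support[OF has_partial_from_derivative[of g g', OF der] supp that]
    by (subst expand) auto
  have cg: "continuous_on UNIV g"
    using der by (meson continuous_on_eq_continuous_at has_derivative_continuous open_UNIV)
  have "((\<lambda>s. newton_form (\<lambda>x. g (s *\<^sub>R x)) (\<lambda>x. g (s *\<^sub>R x))) has_real_derivative
      2 * newton_form (\<lambda>x. g' (1 *\<^sub>R x) x) (\<lambda>x. g (1 *\<^sub>R x))) (at 1 within {1/2..2})"
  \<comment> \<open>For s >= 1/2 the dilated function is supported in a ball of at most twice the
    radius; the absolute value allows for a negative \<open>r\<close>.\<close>
  proof (rule has_real_derivative_newton_form[OF card, where r = "2 * \<bar>r\<bar>" and f' = "\<lambda>s x. g' (s *\<^sub>R x) x"])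
    fix s x assume s: "s \<in> {1/2..2::real}"
    interpret bounded_linear "g' (s *\<^sub>R x)" using der by (rule has_derivative_bounded_linear)
    have "((\<lambda>s. s *\<^sub>R x) has_derivative (\<lambda>h. h *\<^sub>R x)) (at s within {1/2..2})"
      by (auto intro!: derivative_eq_intros)
    from has_derivative_compose[OF this der]
    show "((\<lambda>s. g (s *\<^sub>R x)) has_real_derivative g' (s *\<^sub>R x) x) (at s within {1/2..2})"
      by (simp add: has_field_derivative_def scaleR mult_commute_abs)
    show "g (s *\<^sub>R x) = 0" if "norm x > 2 * \<bar>r\<bar>"
    proof (rule supp)
      have "1 / 2 * norm x \<le> s * norm x" using s by (intro mult_right_mono) auto
      then show "r < norm (s *\<^sub>R x)" using that s by auto
    qed
  next
    show "continuous_on UNIV (\<lambda>x. g (s *\<^sub>R x))" for s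
      by (rule continuous_on_compose2[OF cg]) (auto intro!: continuous_intros)
    have c: "continuous_on ({1/2..2} \<times> UNIV) (\<lambda>p. g' (fst p *\<^sub>R snd p) v)" for v
      by (rule continuous_on_compose2[OF cont]) (auto intro!: continuous_intros)
    show "continuous_on ({1/2..2} \<times> UNIV) (\<lambda>(s, x). g' (s *\<^sub>R x) x)"
      unfolding split_beta expand[of _ "snd _"] by (intro continuous_intros c)
  qed (use supp' in auto)
  then show ?thesis by (simp add: at_within_Icc_at)
qed

text \<open>The derivative of the dilated form at s = 1 is computed twice, by the product rule and
  from the power law s^(-(N+2)), and the two results are equated.\<close>

lemma newton_form_virial:
  fixes g :: "real^'n \<Rightarrow> real"
  assumes card: "CARD('n) \<ge> 3" and der: "\<And>x. (g has_derivative g' x) (at x)"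
    and cont: "\<And>v. continuous_on UNIV (\<lambda>x. g' x v)"
    and supp: "\<And>x. norm x > r \<Longrightarrow> g x = 0"
  shows "2 * newton_form (\<lambda>x. g' x x) g = - (real CARD('n) + 2) * newton_form g g"
proof -
  have "continuous_on UNIV g"
    using der by (meson continuous_on_eq_continuous_at has_derivative_continuous open_UNIV)
  then have m: "g \<in> borel_measurable borel" by (rule borel_measurable_continuous_onI)
  have "((\<lambda>s. newton_form g g * inverse s ^ (CARD('n) + 2)) has_real_derivative
      - (real CARD('n) + 2) * newton_form g g) (at 1)"
    by (auto intro!: derivative_eq_intros)
  then have "((\<lambda>s. newton_form (\<lambda>x. g (s *\<^sub>R x)) (\<lambda>x. g (s *\<^sub>R x))) has_real_derivative
      - (real CARD('n) + 2) * newton_form g g) (at 1)"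
    by (rule has_field_derivative_transform_within[of _ _ _ _ 1])
       (use newton_form_scale[OF card m] in \<open>auto simp: dist_real_def\<close>)
  moreover have "((\<lambda>s. newton_form (\<lambda>x. g (s *\<^sub>R x)) (\<lambda>x. g (s *\<^sub>R x))) has_real_derivative
      2 * newton_form (\<lambda>x. g' x x) g) (at 1)"
    by (rule scaling_derivative_newton_form[where r = r]) (use card der cont supp in auto)
  ultimately show ?thesis by (intro DERIV_unique)
qed

text \<open>As for N >= 3, but \<open>ln s\<close> has derivative 1 at s = 1 and so contributes the
  squared mass.\<close>

lemma newton_form_virial_2:
  fixes g :: "real^'n \<Rightarrow> real"
  assumes card: "CARD('n) = 2" and der: "\<And>x. (g has_derivative g' x) (at x)"
    and cont: "\<And>v. continuous_on UNIV (\<lambda>x. g' x v)"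
    and supp: "\<And>x. norm x > r \<Longrightarrow> g x = 0"
  shows "2 * newton_form (\<lambda>x. g' x x) g = - 4 * newton_form g g - (LINT x|lborel. g x)\<^sup>2"
proof -
  have "continuous_on UNIV g"
    using der by (meson continuous_on_eq_continuous_at has_derivative_continuous open_UNIV)
  then obtain m where m: "bounded_supported r g m"
    using supp by (rule bounded_supported_continuous)
  have "((\<lambda>s. (newton_form g g - ln s * (LINT x|lborel. g x)\<^sup>2) * inverse s ^ 4) has_real_derivative
      - 4 * newton_form g g - (LINT x|lborel. g x)\<^sup>2) (at 1)"
    by (auto intro!: derivative_eq_intros)
  then have "((\<lambda>s. newton_form (\<lambda>x. g (s *\<^sub>R x)) (\<lambda>x. g (s *\<^sub>R x))) has_real_derivative
      - 4 * newton_form g g - (LINT x|lborel. g x)\<^sup>2) (at 1)"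
    by (rule has_field_derivative_transform_within[of _ _ _ _ 1])
       (use newton_form_scale_2[OF card m] in \<open>auto simp: dist_real_def\<close>)
  moreover have "((\<lambda>s. newton_form (\<lambda>x. g (s *\<^sub>R x)) (\<lambda>x. g (s *\<^sub>R x))) has_real_derivative
      2 * newton_form (\<lambda>x. g' x x) g) (at 1)"
    by (rule scaling_derivative_newton_form[where r = r]) (use card der cont supp in auto)
  ultimately show ?thesis by (intro DERIV_unique)
qed

section \<open>Weak form of the conservation laws\<close>

text \<open>A common support radius exists only on bounded time intervals, so the derivative is
  taken within [0, t + 1]. At t this is the same as within [0, infinity).\<close>

lemma time_derivative_LINT:
  fixes g :: "real \<Rightarrow> 'a::euclidean_space \<Rightarrow> real"
  assumes t: "t \<ge> 0"
    and der: "\<And>s x. s \<ge> 0 \<Longrightarrow> ((\<lambda>s. g s x) has_real_derivative g' s x) (at s within {0..})"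
    and cont: "continuous_on ({0..} \<times> UNIV) (\<lambda>p. g (fst p) (snd p))"
    and cont': "continuous_on ({0..} \<times> UNIV) (\<lambda>p. g' (fst p) (snd p))"
    and supp: "\<And>s x. s \<in> {0..t + 1} \<Longrightarrow> norm x > r \<Longrightarrow> g s x = 0"
  shows "((\<lambda>s. LINT x|lborel. g s x) has_real_derivative (LINT x|lborel. g' t x)) (at t within {0..})"
proof -
  have "((\<lambda>s. LINT x|lborel. g s x) has_real_derivative (LINT x|lborel. g' t x)) (at t within {0..t + 1})"
  proof (rule has_real_derivative_LINT_compact_support)
    show "((\<lambda>s. g s x) has_real_derivative g' s x) (at s within {0..t + 1})" if "s \<in> {0..t + 1}" for s x
      by (rule has_field_derivative_subset[OF der]) (use that in auto)
    show "continuous_on UNIV (g s)" if "s \<in> {0..t + 1}" for s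
      using continuous_on_section[of "{0..}" g s] cont that by (simp add: split_beta)
    show "continuous_on ({0..t + 1} \<times> UNIV) (\<lambda>(s, x). g' s x)"
      unfolding split_beta by (rule continuous_on_subset[OF cont']) auto
  qed (use t supp in auto)
  then show ?thesis using at_within_Icc_eq_Ici[of t "t + 1" 0] by simp
qed

section \<open>Time derivatives and powers at vacuum\<close>

lemma time_deriv_eq:
  assumes "t \<ge> 0" "(f has_real_derivative d) (at t within {0..})"
  shows "time_deriv f t = d"
proof -
  have "at t within {0..} \<noteq> bot"
    using assms(1) at_within_Icc_eq_Ici[of t "t + 1" 0] by (metis add_increasing2 at_within_Icc_eq_Ici atLeastAtMost_iff
        islimpt_Icc less_add_one order_le_less_trans order_less_imp_le order_refl trivial_limit_within)
  then show ?thesis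
    unfolding time_deriv_def
    by (rule vector_derivative_within) (use assms in \<open>simp add: has_real_derivative_iff_has_vector_derivative\<close>)
qed

text \<open>The chain rule asks for a two-sided derivative of the outer function, also at the value
  0 that the density takes in vacuum. The absolute value extends the power to both sides, and a > 1
  makes its slope at 0 vanish.\<close>

lemma has_real_derivative_abs_powr:
  fixes s a :: real
  assumes "a > 1"
  shows "((\<lambda>s. \<bar>s\<bar> powr a) has_real_derivative a * \<bar>s\<bar> powr (a - 1) * sgn s) (at s)"
proof (cases "s = 0")
  case True
  have "((\<lambda>h::real. \<bar>h\<bar> powr (a - 1)) \<longlongrightarrow> 0) (at 0)"
    using tendsto_powr'[of "\<lambda>h::real. \<bar>h\<bar>" 0 "at 0" "\<lambda>_. a - 1" "a - 1"] assms
    by (auto intro!: tendsto_eq_intros)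
  moreover have "\<bar>\<bar>h\<bar> powr a / h\<bar> = \<bar>h\<bar> powr (a - 1)" if "h \<noteq> 0" for h :: real
    using that by (simp add: powr_diff)
  ultimately have "((\<lambda>h::real. \<bar>\<bar>h\<bar> powr a / h\<bar>) \<longlongrightarrow> 0) (at 0)"
    by (subst tendsto_cong[where g = "\<lambda>h. \<bar>h\<bar> powr (a - 1)"]) (auto simp: eventually_at_filter)
  then have "((\<lambda>h::real. \<bar>h\<bar> powr a / h) \<longlongrightarrow> 0) (at 0)"
    by (rule tendsto_rabs_zero_cancel)
  then show ?thesis using True by (simp add: has_field_derivative_iff)
next
  case False
  have "((\<lambda>s. \<bar>s\<bar>) has_real_derivative sgn s) (at s)"
  proof (rule has_field_derivative_transform_within[of "\<lambda>x. sgn s * x" _ _ _ "\<bar>s\<bar>"])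
    show "((\<lambda>x. sgn s * x) has_real_derivative sgn s) (at s)"
      by (auto intro!: derivative_eq_intros)
  qed (use False in \<open>auto simp: dist_real_def sgn_if abs_if split: if_splits\<close>)
  from DERIV_powr[OF this, of "\<lambda>_. a" 0] show ?thesis
    using False by (auto simp: powr_diff field_simps)
qed

lemma continuous_on_powr_const:
  fixes f :: "'a::topological_space \<Rightarrow> real"
  assumes "continuous_on S f" "a > 0" "\<And>x. x \<in> S \<Longrightarrow> f x \<ge> 0"
  shows "continuous_on S (\<lambda>x. f x powr a)"
  using assms by (intro continuous_on_powr') (auto intro!: continuous_intros)

text \<open>The derivatives hidden in \<open>C1_on\<close> become explicit functions here: time
  derivatives one-sided at t = 0, space derivatives as linear maps that are continuous for each
  fixed direction.\<close>

locale euler_poisson_flow =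
  fixes K \<gamma> :: real and \<rho> \<rho>t :: "real \<Rightarrow> real^'n \<Rightarrow> real" and \<rho>x :: "real \<Rightarrow> real^'n \<Rightarrow> real^'n \<Rightarrow> real"
    and u ut :: "real \<Rightarrow> real^'n \<Rightarrow> real^'n" and ux :: "real \<Rightarrow> real^'n \<Rightarrow> real^'n \<Rightarrow> real^'n"
    and \<Phi>x :: "real \<Rightarrow> real^'n \<Rightarrow> real^'n \<Rightarrow> real"
  assumes card: "CARD('n) \<ge> 2" and K: "K \<ge> 0" and \<gamma>: "\<gamma> > 1"
    and \<rho>_time: "\<And>t x. t \<ge> 0 \<Longrightarrow> ((\<lambda>s. \<rho> s x) has_real_derivative \<rho>t t x) (at t within {0..})"
    and \<rho>_space: "\<And>t x. t \<ge> 0 \<Longrightarrow> (\<rho> t has_derivative \<rho>x t x) (at x)"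
    and \<rho>_cont: "continuous_on ({0..} \<times> UNIV) (\<lambda>p. \<rho> (fst p) (snd p))"
    and \<rho>t_cont: "continuous_on ({0..} \<times> UNIV) (\<lambda>p. \<rho>t (fst p) (snd p))"
    and \<rho>x_cont: "\<And>v. continuous_on ({0..} \<times> UNIV) (\<lambda>p. \<rho>x (fst p) (snd p) v)"
    and u_time: "\<And>t x. t \<ge> 0 \<Longrightarrow> ((\<lambda>s. u s x) has_vector_derivative ut t x) (at t within {0..})"
    and u_space: "\<And>t x. t \<ge> 0 \<Longrightarrow> (u t has_derivative ux t x) (at x)"
    and u_cont: "continuous_on ({0..} \<times> UNIV) (\<lambda>p. u (fst p) (snd p))"
    and ut_cont: "continuous_on ({0..} \<times> UNIV) (\<lambda>p. ut (fst p) (snd p))"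
    and ux_cont: "\<And>v. continuous_on ({0..} \<times> UNIV) (\<lambda>p. ux (fst p) (snd p) v)"
    and \<Phi>_space: "\<And>t x. t \<ge> 0 \<Longrightarrow> (potential \<rho> t has_derivative \<Phi>x t x) (at x)"
    and \<Phi>x_cont: "\<And>t v. t \<ge> 0 \<Longrightarrow> continuous_on UNIV (\<lambda>x. \<Phi>x t x v)"
    and \<rho>_nonneg: "\<And>t x. t \<ge> 0 \<Longrightarrow> \<rho> t x \<ge> 0"
    and continuity_eq: "\<And>t x. t \<ge> 0 \<Longrightarrow>
        time_deriv (\<lambda>s. \<rho> s x) t + divergence (\<lambda>y. \<rho> t y *\<^sub>R u t y) x = 0"
    and momentum_eq: "\<And>t x i. t \<ge> 0 \<Longrightarrow>
        time_deriv (\<lambda>s. \<rho> s x * u s x $ i) t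
          + divergence (\<lambda>y. (\<rho> t y * u t y $ i) *\<^sub>R u t y) x
          + partial i (pressure K \<gamma> \<rho> t) x
        = \<rho> t x * partial i (potential \<rho> t) x"
    and support: "\<And>T. \<exists>r. \<forall>t\<in>{0..T}. \<forall>x. norm x > r \<longrightarrow> \<rho> t x = 0"
begin

abbreviation e :: "'n \<Rightarrow> real^'n" where "e i \<equiv> axis i 1"
abbreviation P :: "real \<Rightarrow> real^'n \<Rightarrow> real" where "P \<equiv> pressure K \<gamma> \<rho>"
abbreviation \<Phi> :: "real \<Rightarrow> real^'n \<Rightarrow> real" where "\<Phi> \<equiv> potential \<rho>"

text \<open>The i-th partial derivative of the pressure by the chain rule; at vacuum
  \<open>0 powr (\<gamma> - 1) = 0\<close> is the correct value.\<close>

definition Px :: "'n \<Rightarrow> real \<Rightarrow> real^'n \<Rightarrow> real" where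
  "Px i t x = K * \<gamma> * \<rho> t x powr (\<gamma> - 1) * \<rho>x t x (e i)"

lemma section_cont:
  assumes "continuous_on ({0..} \<times> UNIV) (\<lambda>p. f (fst p) (snd p))" "t \<ge> 0"
  shows "continuous_on UNIV (\<lambda>x. f t x)"
  using continuous_on_section[of "{0..}" f t] assms by (simp add: split_beta)

lemmas joint_cont = \<rho>_cont \<rho>t_cont \<rho>x_cont u_cont ut_cont ux_cont

lemma space_cont:
  assumes "t \<ge> 0"
  shows "continuous_on UNIV (\<lambda>x. \<rho> t x)" "continuous_on UNIV (\<lambda>x. \<rho>t t x)" "continuous_on UNIV (\<lambda>x. \<rho>x t x v)"
    "continuous_on UNIV (\<lambda>x. u t x)" "continuous_on UNIV (\<lambda>x. ut t x)" "continuous_on UNIV (\<lambda>x. ux t x v)"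
    "continuous_on UNIV (\<lambda>x. \<Phi> t x)" "continuous_on UNIV (\<lambda>x. \<Phi>x t x v)"
    "continuous_on UNIV (\<lambda>x. P t x)" "continuous_on UNIV (\<lambda>x. Px i t x)"
proof -
  note j = section_cont[OF _ assms]
  show r: "continuous_on UNIV (\<lambda>x. \<rho> t x)" "continuous_on UNIV (\<lambda>x. \<rho>t t x)" "continuous_on UNIV (\<lambda>x. u t x)"
    "continuous_on UNIV (\<lambda>x. ut t x)" "continuous_on UNIV (\<lambda>x. ux t x v)"
    by (intro j joint_cont)+
  show rx: "continuous_on UNIV (\<lambda>x. \<rho>x t x v)" for v by (intro j joint_cont)
  show "continuous_on UNIV (\<lambda>x. \<Phi> t x)"
    using \<Phi>_space[OF assms] by (meson continuous_on_eq_continuous_at has_derivative_continuous open_UNIV)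
  show "continuous_on UNIV (\<lambda>x. \<Phi>x t x v)" by (rule \<Phi>x_cont[OF assms])
  show "continuous_on UNIV (\<lambda>x. P t x)" unfolding pressure_def
    by (intro continuous_intros continuous_on_powr_const r) (use \<rho>_nonneg[OF assms] \<gamma> in auto)
  show "continuous_on UNIV (\<lambda>x. Px i t x)" unfolding Px_def
    by (intro continuous_intros continuous_on_powr_const r rx) (use \<rho>_nonneg[OF assms] \<gamma> in auto)
qed

lemma integrable_\<rho>:
  assumes "t \<ge> 0" "continuous_on UNIV h"
  shows "integrable lborel (\<lambda>x. \<rho> t x * h x)"
proof -
  obtain r where "\<forall>s\<in>{0..t}. \<forall>x. norm x > r \<longrightarrow> \<rho> s x = 0" using support ..
  then show ?thesis
    by (intro integrable_compact_support[of _ r] continuous_intros space_cont assms) (use assms in auto)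
qed

lemma integrable_P:
  assumes "t \<ge> 0" "continuous_on UNIV h"
  shows "integrable lborel (\<lambda>x. P t x * h x)"
proof -
  obtain r where "\<forall>s\<in>{0..t}. \<forall>x. norm x > r \<longrightarrow> \<rho> s x = 0" using support ..
  then show ?thesis
    by (intro integrable_compact_support[of _ r] continuous_intros space_cont assms)
       (use assms in \<open>auto simp: pressure_def\<close>)
qed

lemma \<rho>_partial: "t \<ge> 0 \<Longrightarrow> has_partial i (\<lambda>x. \<rho> t x) (\<lambda>x. \<rho>x t x (e i))"
  by (rule has_partial_from_derivative) (rule \<rho>_space)

lemma \<Phi>_partial: "t \<ge> 0 \<Longrightarrow> has_partial i (\<lambda>x. \<Phi> t x) (\<lambda>x. \<Phi>x t x (e i))"
  by (rule has_partial_from_derivative) (rule \<Phi>_space)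

lemma u_partial:
  assumes "t \<ge> 0"
  shows "has_partial i (\<lambda>x. u t x $ j) (\<lambda>x. ux t x (e i) $ j)"
proof (rule has_partial_from_derivative[where f' = "\<lambda>x v. ux t x v $ j"])
  show "((\<lambda>x. u t x $ j) has_derivative (\<lambda>v. ux t x v $ j)) (at x)" for x
    using bounded_linear.has_derivative[OF bounded_linear_vec_nth u_space[OF assms]] .
qed

lemma P_partial:
  assumes "t \<ge> 0"
  shows "has_partial i (\<lambda>x. P t x) (\<lambda>x. Px i t x)"
  unfolding has_partial_def
proof
  fix x
  have "((\<lambda>h. K * \<bar>\<rho> t (x + h *\<^sub>R e i)\<bar> powr \<gamma>) has_real_derivative
      K * (\<gamma> * \<bar>\<rho> t (x + 0 *\<^sub>R e i)\<bar> powr (\<gamma> - 1) * sgn (\<rho> t (x + 0 *\<^sub>R e i)) * \<rho>x t x (e i))) (at 0)"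
    using \<rho>_partial[OF assms, of i] unfolding has_partial_def
    by (intro DERIV_cmult DERIV_chain2[where f = "\<lambda>s. \<bar>s\<bar> powr \<gamma>"] has_real_derivative_abs_powr \<gamma>) auto
  moreover have "K * (\<gamma> * \<bar>\<rho> t (x + 0 *\<^sub>R e i)\<bar> powr (\<gamma> - 1) * sgn (\<rho> t (x + 0 *\<^sub>R e i)) * \<rho>x t x (e i)) = Px i t x"
    using \<rho>_nonneg[OF assms, of x] by (cases "\<rho> t x = 0") (auto simp: Px_def sgn_if)
  ultimately show "((\<lambda>h. P t (x + h *\<^sub>R e i)) has_real_derivative Px i t x) (at 0)"
    using \<rho>_nonneg[OF assms] by (simp add: pressure_def)
qed

lemma P_time:
  assumes "t \<ge> 0"
  shows "((\<lambda>s. P s x) has_real_derivative K * \<gamma> * \<rho> t x powr (\<gamma> - 1) * \<rho>t t x) (at t within {0..})"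
proof -
  have "((\<lambda>s. K * \<bar>\<rho> s x\<bar> powr \<gamma>) has_real_derivative
      K * (\<gamma> * \<bar>\<rho> t x\<bar> powr (\<gamma> - 1) * sgn (\<rho> t x) * \<rho>t t x)) (at t within {0..})"
    by (intro DERIV_cmult DERIV_chain2[where f = "\<lambda>s. \<bar>s\<bar> powr \<gamma>"] has_real_derivative_abs_powr \<gamma> \<rho>_time assms)
  moreover have "K * (\<gamma> * \<bar>\<rho> t x\<bar> powr (\<gamma> - 1) * sgn (\<rho> t x) * \<rho>t t x) = K * \<gamma> * \<rho> t x powr (\<gamma> - 1) * \<rho>t t x"
    using \<rho>_nonneg[OF assms, of x] by (cases "\<rho> t x = 0") (auto simp: sgn_if)
  ultimately have "((\<lambda>s. K * \<bar>\<rho> s x\<bar> powr \<gamma>) has_real_derivative K * \<gamma> * \<rho> t x powr (\<gamma> - 1) * \<rho>t t x) (at t within {0..})"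
    by simp
  then show ?thesis
    by (rule has_field_derivative_transform_within[of _ _ _ _ 1])
       (use assms \<rho>_nonneg in \<open>auto simp: pressure_def\<close>)
qed

lemma \<rho>t_eq: "t \<ge> 0 \<Longrightarrow> \<rho>t t x = - divergence (\<lambda>y. \<rho> t y *\<^sub>R u t y) x"
  using continuity_eq[of t x] time_deriv_eq[OF _ \<rho>_time, of t x] by simp

lemma u_nth_time: "t \<ge> 0 \<Longrightarrow> ((\<lambda>s. u s x $ i) has_real_derivative ut t x $ i) (at t within {0..})"
  unfolding has_real_derivative_iff_has_vector_derivative
  by (rule bounded_linear.has_vector_derivative[OF bounded_linear_vec_nth u_time])

definition mt :: "'n \<Rightarrow> real \<Rightarrow> real^'n \<Rightarrow> real" where
  "mt i t x = \<rho>t t x * u t x $ i + \<rho> t x * ut t x $ i"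

lemma momentum_time: "t \<ge> 0 \<Longrightarrow> ((\<lambda>s. \<rho> s x * u s x $ i) has_real_derivative mt i t x) (at t within {0..})"
  unfolding mt_def by (auto intro!: derivative_eq_intros \<rho>_time u_nth_time)

lemma mt_eq:
  assumes "t \<ge> 0"
  shows "mt i t x = - divergence (\<lambda>y. (\<rho> t y * u t y $ i) *\<^sub>R u t y) x - Px i t x + \<rho> t x * \<Phi>x t x (e i)"
  using momentum_eq[OF assms, of x i] time_deriv_eq[OF assms momentum_time[OF assms]]
    has_partial_imp_partial[OF P_partial[OF assms, of i]] has_partial_imp_partial[OF \<Phi>_partial[OF assms, of i]]
  by simp

text \<open>The compact support of \<rho> kills the boundary terms, so test functions may grow at
  infinity. It is applied to 1 for mass, x . x for inertia, and u . u and \<Phi> for energy.\<close>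

lemma continuity_weak:
  assumes t: "t \<ge> 0"
    and \<phi>: "\<And>j. has_partial j \<phi> (\<phi>' j)" "continuous_on UNIV \<phi>" "\<And>j. continuous_on UNIV (\<phi>' j)"
  shows "integrable lborel (\<lambda>x. \<phi> x * \<rho>t t x)"
    "(LINT x|lborel. \<phi> x * \<rho>t t x) = (LINT x|lborel. (\<Sum>j\<in>UNIV. \<rho> t x * u t x $ j * \<phi>' j x))"
proof -
  obtain r where r: "\<forall>s\<in>{0..t}. \<forall>x. norm x > r \<longrightarrow> \<rho> s x = 0" using support ..
  note parts = LINT_divergence_by_parts[where F = "\<lambda>y. \<rho> t y *\<^sub>R u t y" and r = r
      and F' = "\<lambda>j x. \<rho>x t x (e j) * u t x $ j + \<rho> t x * ux t x (e j) $ j", OF _ _ _ \<phi>]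
  have *: "integrable lborel (\<lambda>x. \<phi> x * divergence (\<lambda>y. \<rho> t y *\<^sub>R u t y) x)"
    "(LINT x|lborel. \<phi> x * divergence (\<lambda>y. \<rho> t y *\<^sub>R u t y) x) =
       - (LINT x|lborel. (\<Sum>j\<in>UNIV. (\<rho> t x *\<^sub>R u t x) $ j * \<phi>' j x))"
    by (rule parts; use r t in \<open>auto intro!: has_partial_mult \<rho>_partial u_partial continuous_intros space_cont\<close>)+
  show "integrable lborel (\<lambda>x. \<phi> x * \<rho>t t x)" using * \<rho>t_eq[OF t] by simp
  show "(LINT x|lborel. \<phi> x * \<rho>t t x) = (LINT x|lborel. (\<Sum>j\<in>UNIV. \<rho> t x * u t x $ j * \<phi>' j x))"
    using * \<rho>t_eq[OF t] by simp
qed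

lemma pressure_weak:
  assumes t: "t \<ge> 0"
    and \<phi>: "has_partial i \<phi> \<phi>'" "continuous_on UNIV \<phi>" "continuous_on UNIV \<phi>'"
  shows "integrable lborel (\<lambda>x. \<phi> x * Px i t x)"
    "(LINT x|lborel. \<phi> x * Px i t x) = - (LINT x|lborel. P t x * \<phi>' x)"
proof -
  obtain r where r: "\<forall>s\<in>{0..t}. \<forall>x. norm x > r \<longrightarrow> \<rho> s x = 0" using support ..
  then have P0: "P t x = 0" if "norm x > r" for x using that t by (simp add: pressure_def)
  show "integrable lborel (\<lambda>x. \<phi> x * Px i t x)"
    "(LINT x|lborel. \<phi> x * Px i t x) = - (LINT x|lborel. P t x * \<phi>' x)"
    by (rule LINT_by_parts[OF P_partial[OF t] _ _ \<phi>, of r];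
        use P0 t in \<open>auto intro!: space_cont\<close>)+
qed

text \<open>Tested with x_i this produces the virial identity, tested with u_i the balance of
  kinetic energy.\<close>

lemma momentum_weak:
  assumes t: "t \<ge> 0"
    and \<phi>: "\<And>j. has_partial j \<phi> (\<phi>' j)" "continuous_on UNIV \<phi>" "\<And>j. continuous_on UNIV (\<phi>' j)"
  shows "integrable lborel (\<lambda>x. \<phi> x * mt i t x)"
    "(LINT x|lborel. \<phi> x * mt i t x) =
       (LINT x|lborel. (\<Sum>j\<in>UNIV. \<rho> t x * u t x $ i * u t x $ j * \<phi>' j x))
       - (LINT x|lborel. \<phi> x * Px i t x) + (LINT x|lborel. \<rho> t x * (\<phi> x * \<Phi>x t x (e i)))"
proof -
  obtain r where r: "\<forall>s\<in>{0..t}. \<forall>x. norm x > r \<longrightarrow> \<rho> s x = 0" using support ..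
  let ?F = "\<lambda>y. (\<rho> t y * u t y $ i) *\<^sub>R u t y"
  note parts = LINT_divergence_by_parts[where F = ?F and r = r
      and F' = "\<lambda>j x. (\<rho>x t x (e j) * u t x $ i + \<rho> t x * ux t x (e j) $ i) * u t x $ j
         + (\<rho> t x * u t x $ i) * ux t x (e j) $ j", OF _ _ _ \<phi>]
  have d: "integrable lborel (\<lambda>x. \<phi> x * divergence ?F x)"
    "(LINT x|lborel. \<phi> x * divergence ?F x) = - (LINT x|lborel. (\<Sum>j\<in>UNIV. ?F x $ j * \<phi>' j x))"
    by (rule parts; use r t in \<open>auto intro!: has_partial_mult \<rho>_partial u_partial continuous_intros space_cont\<close>)+
  note p = pressure_weak(1)[OF t \<phi>(1) \<phi>(2) \<phi>(3), of i]
  have f: "integrable lborel (\<lambda>x. \<rho> t x * (\<phi> x * \<Phi>x t x (e i)))"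
    by (intro integrable_\<rho> continuous_intros space_cont t \<phi>)
  have eq: "\<phi> x * mt i t x = - (\<phi> x * divergence ?F x) - \<phi> x * Px i t x + \<rho> t x * (\<phi> x * \<Phi>x t x (e i))" for x
    unfolding mt_eq[OF t] by (simp add: algebra_simps)
  show "integrable lborel (\<lambda>x. \<phi> x * mt i t x)" unfolding eq using d p f by auto
  show "(LINT x|lborel. \<phi> x * mt i t x) =
       (LINT x|lborel. (\<Sum>j\<in>UNIV. \<rho> t x * u t x $ i * u t x $ j * \<phi>' j x))
       - (LINT x|lborel. \<phi> x * Px i t x) + (LINT x|lborel. \<rho> t x * (\<phi> x * \<Phi>x t x (e i)))"
    unfolding eq using d p f by simp
qed

end

section \<open>Growth of functions with a lower bound on the second derivative\<close>

text \<open>Young's inequality with weights 1/a and 1 - 1/a, applied to y^a and 1.\<close>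

lemma powr_Bernoulli:
  fixes y a :: real
  assumes "y \<ge> 0" "a > 1"
  shows "1 + a * (y - 1) \<le> y powr a"
proof (cases "y = 0")
  case False
  then have y: "y > 0" using assms by simp
  have "(y powr a) powr (1 / a) * 1 powr (1 - 1 / a) \<le> 1 / a * y powr a + (1 - 1 / a) * 1"
    by (rule Youngs_inequality_0) (use assms y in auto)
  then have "y \<le> 1 / a * y powr a + (1 - 1 / a)"
    using assms y by (simp add: powr_powr)
  then have "a * y \<le> a * (1 / a * y powr a + (1 - 1 / a))"
    using assms by (intro mult_left_mono) auto
  then show ?thesis using assms by (simp add: algebra_simps)
qed (use assms in auto)

text \<open>The power lies above its tangent at \<open>m\<close>, which is the convexity behind
  Jensen's inequality. It is the Bernoulli inequality at y = s / m, rescaled.\<close>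

lemma powr_tangent:
  fixes s m a :: real
  assumes "s \<ge> 0" "m > 0" "a > 1"
  shows "m powr a + a * m powr (a - 1) * (s - m) \<le> s powr a"
proof -
  have "m powr a * (1 + a * (s / m - 1)) \<le> m powr a * (s / m) powr a"
    using powr_Bernoulli[of "s / m" a] assms by (intro mult_left_mono) auto
  also have "\<dots> = s powr a" using assms by (simp add: powr_divide)
  finally show ?thesis using assms by (simp add: powr_diff field_simps)
qed

lemma mvt_atLeast_0:
  fixes f :: "real \<Rightarrow> real"
  assumes der: "\<And>s. s \<ge> 0 \<Longrightarrow> (f has_real_derivative f' s) (at s within {0..})"
    and ab: "0 \<le> a" "a \<le> b"
  shows "\<exists>x\<in>{a..b}. f b - f a = f' x * (b - a)"
proof (rule mvt_very_simple[OF ab(2)])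
  fix x assume "a \<le> x" "x \<le> b"
  then have "(f has_real_derivative f' x) (at x within {a..b})"
    using ab by (intro has_field_derivative_subset[OF der]) auto
  then show "(f has_derivative (*) (f' x)) (at x within {a..b})"
    by (simp add: has_field_derivative_def)
qed

lemma nondecreasing_from_derivative:
  fixes f :: "real \<Rightarrow> real"
  assumes "\<And>s. s \<ge> 0 \<Longrightarrow> (f has_real_derivative f' s) (at s within {0..})"
    and nonneg: "\<And>s. s \<ge> 0 \<Longrightarrow> f' s \<ge> 0" and ab: "0 \<le> a" "a \<le> b"
  shows "f a \<le> f b"
proof -
  obtain x where x: "x \<in> {a..b}" "f b - f a = f' x * (b - a)"
    using mvt_atLeast_0[OF assms(1) ab] by blast
  then have "f' x * (b - a) \<ge> 0" using nonneg[of x] ab by simp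
  then show ?thesis using x(2) by simp
qed

text \<open>Two integrations. The factor 2 in the first derivative matches that of
  \<open>inertia\<close>, so the bound \<open>c\<close> on \<open>f2\<close> is itself the
  coefficient of t^2.\<close>

lemma quadratic_growth:
  fixes f f1 f2 :: "real \<Rightarrow> real"
  assumes 1: "\<And>s. s \<ge> 0 \<Longrightarrow> (f has_real_derivative 2 * f1 s) (at s within {0..})"
    and 2: "\<And>s. s \<ge> 0 \<Longrightarrow> (f1 has_real_derivative f2 s) (at s within {0..})"
    and c: "\<And>s. s \<ge> 0 \<Longrightarrow> f2 s \<ge> c" and t: "t \<ge> 0"
  shows "f t \<ge> f 0 + 2 * f1 0 * t + c * t\<^sup>2"
proof -
  have f1: "f1 s \<ge> f1 0 + c * s" if "s \<ge> 0" for s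
    using nondecreasing_from_derivative[of "\<lambda>s. f1 s - c * s" "\<lambda>s. f2 s - c" 0 s] 2 c that
    by (force intro!: derivative_eq_intros)
  have "((\<lambda>s. f s - 2 * f1 0 * s - c * s\<^sup>2) has_real_derivative 2 * (f1 s - f1 0 - c * s)) (at s within {0..})"
    if "s \<ge> 0" for s
    using 1[OF that] by (auto intro!: derivative_eq_intros simp: algebra_simps)
  from nondecreasing_from_derivative[OF this, of 0 t] f1 t show ?thesis by force
qed

text \<open>Division by M t^2 leaves c / M in the limit. The bound may start at a late time
  \<open>T\<close>, as happens in dimension 2, and extended reals accommodate an unbounded
  quotient.\<close>

lemma Liminf_radius_bound:
  fixes R :: "real \<Rightarrow> real"
  assumes M: "M > 0" and R: "\<And>t. t \<ge> 0 \<Longrightarrow> R t \<ge> 0" and T: "T \<ge> 0"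
    and bound: "\<And>t. t \<ge> T \<Longrightarrow> a + b * t + c * t\<^sup>2 \<le> M * (R t)\<^sup>2"
  shows "Liminf at_top (\<lambda>t. ereal (R t / t)) \<ge> ereal (sqrt (c / M))"
proof -
  let ?g = "\<lambda>t::real. sqrt ((a / t\<^sup>2 + b / t + c) / M)"
  have "((\<lambda>t::real. a / t\<^sup>2 + b / t + c) \<longlongrightarrow> 0 + 0 + c) at_top"
    by (intro tendsto_add tendsto_const tendsto_divide_0[OF tendsto_const]
        filterlim_at_top_imp_at_infinity filterlim_pow_at_top filterlim_ident) auto
  then have "(?g \<longlongrightarrow> sqrt (c / M)) at_top"
    using tendsto_real_sqrt[OF tendsto_divide[OF _ tendsto_const, of _ c at_top M]] M by simp
  then have "Liminf at_top (\<lambda>t. ereal (?g t)) = ereal (sqrt (c / M))"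
    by (intro lim_imp_Liminf) auto
  moreover have "Liminf at_top (\<lambda>t. ereal (?g t)) \<le> Liminf at_top (\<lambda>t. ereal (R t / t))"
  proof (rule Liminf_mono)
    show "eventually (\<lambda>t. ereal (?g t) \<le> ereal (R t / t)) at_top"
      using eventually_ge_at_top[of "max T 1"]
    proof eventually_elim
      case (elim t)
      then have t: "t > 0" "t \<ge> T" by auto
      have "(a / t\<^sup>2 + b / t + c) / M = (a + b * t + c * t\<^sup>2) / (M * t\<^sup>2)"
        using t M by (simp add: field_simps power2_eq_square)
      also have "\<dots> \<le> (M * (R t)\<^sup>2) / (M * t\<^sup>2)"
        using bound[OF t(2)] M by (intro divide_right_mono) auto
      also have "\<dots> = (R t / t)\<^sup>2" using M by (simp add: power_divide)
      finally have "?g t \<le> sqrt ((R t / t)\<^sup>2)" by (rule real_sqrt_le_mono)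
      also have "\<dots> = R t / t" using R[of t] t by simp
      finally show ?case by simp
    qed
  qed
  ultimately show ?thesis by simp
qed

text \<open>With \<open>L = sqrt (f + 1)\<close> one has \<open>L'' \<ge> m / (2 L)\<close>. A convex \<open>L\<close> with bounded slope would
  satisfy \<open>L'' \<ge> const / (1 + t)\<close>, whose integral diverges; hence the slope of \<open>L\<close> exceeds every
  given number \<open>A\<close>.\<close>

lemma superlinear_growth:
  fixes f f1 f2 k :: "real \<Rightarrow> real"
  assumes 1: "\<And>s. s \<ge> 0 \<Longrightarrow> (f has_real_derivative 2 * f1 s) (at s within {0..})"
    and 2: "\<And>s. s \<ge> 0 \<Longrightarrow> (f1 has_real_derivative f2 s) (at s within {0..})"
    and f: "\<And>s. s \<ge> 0 \<Longrightarrow> f s \<ge> 0"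
    and f2: "\<And>s. s \<ge> 0 \<Longrightarrow> f2 s \<ge> m / 2 + k s"
    and cs: "\<And>s. s \<ge> 0 \<Longrightarrow> (f1 s)\<^sup>2 \<le> (f s + 1) * k s"
    and m: "m > 0" and A: "A > 0"
  obtains T b where "T \<ge> 0" "\<And>t. t \<ge> T \<Longrightarrow> (b + A * t)\<^sup>2 \<le> f t + 1"
proof -
  define L where "L = (\<lambda>t. sqrt (f t + 1))"
  define L1 where "L1 = (\<lambda>t. f1 t / L t)"
  have L: "L t > 0" "(L t)\<^sup>2 = f t + 1" if "t \<ge> 0" for t
    using f[OF that] by (auto simp: L_def)
  have dL: "(L has_real_derivative L1 t) (at t within {0..})" if "t \<ge> 0" for t
    unfolding L_def using 1[OF that] f[OF that]
    by (auto intro!: derivative_eq_intros simp: L1_def L_def field_simps)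
  have dL1: "(L1 has_real_derivative (f2 t * L t - f1 t * L1 t) / (L t * L t)) (at t within {0..})" if "t \<ge> 0" for t
    unfolding L1_def using 2[OF that] dL[OF that] L(1)[OF that]
    by (auto intro!: derivative_eq_intros simp: L1_def)
  \<comment> \<open>By \<open>cs\<close> the loss \<open>f1 t * L1 t\<close> is at most
    \<open>L t * k t\<close>, so the part \<open>k\<close> of \<open>f2\<close> pays for it entirely
    and \<open>m / 2\<close> is what remains.\<close>
  have L2: "m / (2 * L t) \<le> (f2 t * L t - f1 t * L1 t) / (L t * L t)" if "t \<ge> 0" for t
  proof -
    have "f1 t * L1 t * L t = (f1 t)\<^sup>2"
      using L(1)[OF that] by (simp add: L1_def power2_eq_square)
    also have "\<dots> \<le> (L t)\<^sup>2 * k t" using cs[OF that] L(2)[OF that] by simp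
    finally have "f1 t * L1 t \<le> L t * k t" using L(1)[OF that] by (simp add: power2_eq_square mult.assoc)
    moreover have "L t * (m / 2 + k t) \<le> L t * f2 t" using f2[OF that] L(1)[OF that] by simp
    ultimately have "L t * m / 2 \<le> f2 t * L t - f1 t * L1 t" by (simp add: algebra_simps)
    then have "(L t * m / 2) / (L t * L t) \<le> (f2 t * L t - f1 t * L1 t) / (L t * L t)"
      by (rule divide_right_mono) auto
    then show ?thesis using L(1)[OF that] by simp
  qed
  have mono: "L1 a \<le> L1 b" if "0 \<le> a" "a \<le> b" for a b
  proof (rule nondecreasing_from_derivative[OF dL1 _ that])
    show "0 \<le> (f2 s * L s - f1 s * L1 s) / (L s * L s)" if "s \<ge> 0" for s
      using order_trans[OF _ L2[OF that], of 0] m L(1)[OF that] by simp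
  qed
  have "\<exists>T\<ge>0. L1 T \<ge> A"
  proof (rule ccontr)
    assume "\<not> ?thesis"
    then have lt: "L1 t < A" if "t \<ge> 0" for t using that by force
    have lin: "L t \<le> L 0 + A * t" if "t \<ge> 0" for t
    proof -
      have "A * 0 - L 0 \<le> A * t - L t"
        by (rule nondecreasing_from_derivative[of "\<lambda>t. A * t - L t" "\<lambda>t. A - L1 t"])
           (use dL lt that in \<open>auto intro!: derivative_eq_intros less_imp_le\<close>)
      then show ?thesis by simp
    qed
    define h where "h = (\<lambda>t. m / (2 * A) * ln (L 0 + A * t))"
    have pos: "L 0 + A * t > 0" if "t \<ge> 0" for t using L(1)[of 0] A that by (simp add: add_pos_nonneg)
    have hle: "L1 0 - h 0 \<le> L1 t - h t" if "t \<ge> 0" for t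
    proof (rule nondecreasing_from_derivative[of "\<lambda>t. L1 t - h t"
          "\<lambda>t. (f2 t * L t - f1 t * L1 t) / (L t * L t) - m / (2 * (L 0 + A * t))"])
      fix s :: real assume s: "s \<ge> 0"
      show "((\<lambda>t. L1 t - h t) has_real_derivative
          (f2 s * L s - f1 s * L1 s) / (L s * L s) - m / (2 * (L 0 + A * s))) (at s within {0..})"
        unfolding h_def using dL1[OF s] pos[OF s] A
        by (auto intro!: derivative_eq_intros simp: divide_simps) (simp add: algebra_simps)
      have "m / (2 * (L 0 + A * s)) \<le> m / (2 * L s)"
        using lin[OF s] L(1)[OF s] m by (intro divide_left_mono) auto
      then show "0 \<le> (f2 s * L s - f1 s * L1 s) / (L s * L s) - m / (2 * (L 0 + A * s))"
        using L2[OF s] by simp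
    qed (use that in auto)
    have "filterlim (\<lambda>t. ln (L 0 + A * t)) at_top at_top"
      by (intro filterlim_compose[OF ln_at_top] filterlim_tendsto_add_at_top[OF tendsto_const]
          filterlim_tendsto_pos_mult_at_top[OF tendsto_const A filterlim_ident])
    then have "filterlim h at_top at_top"
      unfolding h_def using m A by (intro filterlim_tendsto_pos_mult_at_top[OF tendsto_const]) auto
    then have "eventually (\<lambda>t. h t \<ge> A + h 0 - L1 0) at_top" by (simp add: filterlim_at_top)
    with eventually_ge_at_top[of 0] have "eventually (\<lambda>t::real. False) at_top"
    proof eventually_elim
      case (elim t)
      then show ?case using hle[of t] lt[of t] by simp
    qed
    then show False by simp
  qed
  then obtain T where T: "T \<ge> 0" "L1 T \<ge> A" by blast
  have "(L T - A * T + A * t)\<^sup>2 \<le> f t + 1" if t: "t \<ge> T" for t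
  proof -
    obtain x where x: "x \<ge> T" "L t - L T = L1 x * (t - T)"
      using mvt_atLeast_0[OF dL T(1) t] by auto
    have "A * (t - T) \<le> L1 x * (t - T)"
      using mono[OF T(1) x(1)] T(2) t by (intro mult_right_mono) auto
    then have "L T - A * T + A * t \<le> L t" using x(2) by (simp add: algebra_simps)
    \<comment> \<open>The lower bound has to be nonnegative before it may be squared.\<close>
    moreover have "0 \<le> L T - A * T + A * t"
      using L(1)[OF T(1)] mult_left_mono[OF t, of A] A by linarith
    ultimately have "(L T - A * T + A * t)\<^sup>2 \<le> (L t)\<^sup>2" by (rule power_mono)
    then show ?thesis using L(2)[of t] T t by simp
  qed
  with T(1) show thesis by (rule that)
qed

section \<open>Virial identity and conservation of mass and energy\<close>

lemma constant_from_zero_derivative: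
  fixes f :: "real \<Rightarrow> real"
  assumes "\<And>t. t \<ge> 0 \<Longrightarrow> (f has_real_derivative 0) (at t within {0..})" and "s \<ge> 0" "t \<ge> 0"
  shows "f s = f t"
proof -
  have "\<exists>c. \<forall>t\<in>{0..}. f t = c"
    by (rule has_field_derivative_zero_constant) (use assms(1) in auto)
  then show ?thesis using assms(2,3) by auto
qed

context euler_poisson_flow
begin

definition total_mass :: "real \<Rightarrow> real" where "total_mass t = (LINT x|lborel. \<rho> t x)"
definition inertia :: "real \<Rightarrow> real" where "inertia t = (LINT x|lborel. \<rho> t x * (x \<bullet> x))"
definition radial_momentum :: "real \<Rightarrow> real" where "radial_momentum t = (LINT x|lborel. \<rho> t x * (x \<bullet> u t x))"
text \<open>Twice the kinetic energy; likewise \<open>self_energy\<close> is the plain form. The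
  weights are supplied in \<open>total_energy\<close>.\<close>

definition kinetic :: "real \<Rightarrow> real" where "kinetic t = (LINT x|lborel. \<rho> t x * (u t x \<bullet> u t x))"
definition total_pressure :: "real \<Rightarrow> real" where "total_pressure t = (LINT x|lborel. P t x)"
definition self_energy :: "real \<Rightarrow> real" where "self_energy t = newton_form (\<rho> t) (\<rho> t)"
text \<open>\<open>\<Phi>x t x x\<close> is x . grad \<Phi>, the derivative at x along the position
  vector.\<close>

definition virial :: "real \<Rightarrow> real" where "virial t = (LINT x|lborel. \<rho> t x * \<Phi>x t x x)"
definition total_energy :: "real \<Rightarrow> real" where
  "total_energy t = kinetic t / 2 + total_pressure t / (\<gamma> - 1) - self_energy t / 2"

lemma \<Phi>x_expand:
  assumes "t \<ge> 0"
  shows "\<Phi>x t x v = (\<Sum>i\<in>UNIV. v $ i * \<Phi>x t x (e i))"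
  by (rule bounded_linear_axis_expansion[OF has_derivative_bounded_linear[OF \<Phi>_space[OF assms]]])

lemma \<rho>x_expand:
  assumes "t \<ge> 0"
  shows "\<rho>x t x v = (\<Sum>i\<in>UNIV. v $ i * \<rho>x t x (e i))"
  by (rule bounded_linear_axis_expansion[OF has_derivative_bounded_linear[OF \<rho>_space[OF assms]]])

lemma newton_eq_potential: "newton (\<rho> t) = potential \<rho> t"
  by (simp add: fun_eq_iff newton_def potential_def)

lemma total_mass_deriv:
  assumes t: "t \<ge> 0"
  shows "(total_mass has_real_derivative 0) (at t within {0..})"
proof -
  obtain r where r: "\<forall>s\<in>{0..t+1}. \<forall>x. norm x > r \<longrightarrow> \<rho> s x = 0" using support ..
  have "(total_mass has_real_derivative (LINT x|lborel. \<rho>t t x)) (at t within {0..})"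
    unfolding total_mass_def
    by (rule time_derivative_LINT[OF t \<rho>_time \<rho>_cont \<rho>t_cont, of r]) (use r in auto)
  then show ?thesis
    using continuity_weak(2)[OF t has_partial_const, of 1] by (simp add: continuous_on_const)
qed

lemma inertia_deriv:
  assumes t: "t \<ge> 0"
  shows "(inertia has_real_derivative 2 * radial_momentum t) (at t within {0..})"
proof -
  obtain r where r: "\<forall>s\<in>{0..t+1}. \<forall>x. norm x > r \<longrightarrow> \<rho> s x = 0" using support ..
  have "(inertia has_real_derivative (LINT x|lborel. \<rho>t t x * (x \<bullet> x))) (at t within {0..})"
    unfolding inertia_def
  proof (rule time_derivative_LINT[OF t, where r = r])
    show "((\<lambda>s. \<rho> s x * (x \<bullet> x)) has_real_derivative \<rho>t s x * (x \<bullet> x)) (at s within {0..})"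
      if "s \<ge> 0" for s x
      by (rule DERIV_cmult_right[OF \<rho>_time[OF that]])
  qed (use r in \<open>auto intro!: continuous_intros joint_cont\<close>)
  also have "(LINT x|lborel. \<rho>t t x * (x \<bullet> x)) = (LINT x|lborel. (x \<bullet> x) * \<rho>t t x)"
    by (simp add: mult.commute)
  also have "\<dots> = (LINT x|lborel. (\<Sum>j\<in>UNIV. \<rho> t x * u t x $ j * (2 * x $ j)))"
    by (rule continuity_weak(2)[OF t has_partial_inner_self]) (intro continuous_intros)+
  also have "\<dots> = (LINT x|lborel. 2 * (\<rho> t x * (x \<bullet> u t x)))"
    by (simp add: inner_vec_def sum_distrib_left mult_ac)
  finally show ?thesis by (simp add: radial_momentum_def)
qed

lemma momentum_cont: "continuous_on ({0..} \<times> UNIV) (\<lambda>p. mt i (fst p) (snd p))"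
  unfolding mt_def by (intro continuous_intros joint_cont)

text \<open>Lagrange-Jacobi identity: the i-th momentum equation is tested with x_i and summed over
  i. As the partials of x_i are Kronecker deltas, the flux leaves \<rho> |u|^2 and each of the N
  components one integral of the pressure.\<close>

lemma radial_momentum_deriv:
  assumes t: "t \<ge> 0"
  shows "(radial_momentum has_real_derivative
      kinetic t + real CARD('n) * total_pressure t + virial t) (at t within {0..})"
proof -
  obtain r where r: "\<forall>s\<in>{0..t+1}. \<forall>x. norm x > r \<longrightarrow> \<rho> s x = 0" using support ..
  have "radial_momentum = (\<lambda>t. LINT x|lborel. (\<Sum>i\<in>UNIV. x $ i * (\<rho> t x * u t x $ i)))"
    by (simp add: radial_momentum_def inner_vec_def sum_distrib_left mult_ac fun_eq_iff)
  moreover have "((\<lambda>t. LINT x|lborel. (\<Sum>i\<in>UNIV. x $ i * (\<rho> t x * u t x $ i))) has_real_derivative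
      (LINT x|lborel. (\<Sum>i\<in>UNIV. x $ i * mt i t x))) (at t within {0..})"
  proof (rule time_derivative_LINT[OF t, where r = r])
    show "((\<lambda>s. \<Sum>i\<in>UNIV. x $ i * (\<rho> s x * u s x $ i)) has_real_derivative
        (\<Sum>i\<in>UNIV. x $ i * mt i s x)) (at s within {0..})" if "s \<ge> 0" for s x
      by (intro DERIV_sum DERIV_cmult momentum_time that)
  qed (use r in \<open>auto intro!: continuous_intros joint_cont momentum_cont\<close>)
  moreover have weak: "integrable lborel (\<lambda>x. x $ i * mt i t x)"
    "(LINT x|lborel. x $ i * mt i t x) = (LINT x|lborel. \<rho> t x * (u t x $ i * u t x $ i))
       + total_pressure t + (LINT x|lborel. \<rho> t x * (x $ i * \<Phi>x t x (e i)))" for i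
  proof -
    have c: "continuous_on UNIV (\<lambda>x::real^'n. x $ i)" "continuous_on UNIV (\<lambda>x::real^'n. if j = i then 1 else 0 :: real)" for j
      by (auto intro!: continuous_intros)
    show "integrable lborel (\<lambda>x. x $ i * mt i t x)"
      by (rule momentum_weak(1)[OF t has_partial_nth c])
    show "(LINT x|lborel. x $ i * mt i t x) = (LINT x|lborel. \<rho> t x * (u t x $ i * u t x $ i))
       + total_pressure t + (LINT x|lborel. \<rho> t x * (x $ i * \<Phi>x t x (e i)))"
      unfolding momentum_weak(2)[OF t has_partial_nth c] pressure_weak(2)[OF t has_partial_nth c]
      by (simp add: if_distrib[of "(*) _"] total_pressure_def mult.assoc cong: if_cong)
  qed
  moreover have "(LINT x|lborel. (\<Sum>i\<in>UNIV. x $ i * mt i t x)) =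
      kinetic t + real CARD('n) * total_pressure t + virial t"
  proof -
    have i1: "integrable lborel (\<lambda>x. \<rho> t x * (u t x $ i * u t x $ i))" for i
      by (intro integrable_\<rho> t continuous_intros space_cont)
    have i2: "integrable lborel (\<lambda>x. \<rho> t x * (x $ i * \<Phi>x t x (e i)))" for i
      by (intro integrable_\<rho> t continuous_intros space_cont)
    have "kinetic t = (\<Sum>i\<in>UNIV. LINT x|lborel. \<rho> t x * (u t x $ i * u t x $ i))"
      using i1 by (simp add: kinetic_def inner_vec_def sum_distrib_left Bochner_Integration.integral_sum)
    moreover have "virial t = (\<Sum>i\<in>UNIV. LINT x|lborel. \<rho> t x * (x $ i * \<Phi>x t x (e i)))"
      unfolding virial_def using i2
      by (subst \<Phi>x_expand[OF t]) (simp add: sum_distrib_left Bochner_Integration.integral_sum)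
    ultimately show ?thesis
      using weak by (simp add: Bochner_Integration.integral_sum sum.distrib)
  qed
  ultimately show ?thesis by simp
qed

text \<open>Integration by parts moves the gradient from \<Phi> to the field \<rho> x, whose
  divergence is x . grad \<rho> + N \<rho>.\<close>

lemma virial_eq_newton_form:
  assumes t: "t \<ge> 0"
  shows "virial t = - newton_form (\<lambda>x. \<rho>x t x x) (\<rho> t) - real CARD('n) * self_energy t"
proof -
  obtain r where r: "\<forall>s\<in>{0..t}. \<forall>x. norm x > r \<longrightarrow> \<rho> s x = 0" using support ..
  let ?F = "\<lambda>x. \<rho> t x *\<^sub>R x"
  have F: "has_partial j (\<lambda>x. ?F x $ j) (\<lambda>x. \<rho>x t x (e j) * x $ j + \<rho> t x * 1)" for j
    using has_partial_mult[OF \<rho>_partial[OF t] has_partial_nth, of j j] by simp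
  note parts = LINT_divergence_by_parts[where F = ?F and r = r and g = "\<Phi> t", OF F _ _ \<Phi>_partial[OF t]]
  have div: "divergence ?F x = \<rho>x t x x + real CARD('n) * \<rho> t x" for x
    unfolding divergence_def using has_partial_imp_partial[OF F] \<rho>x_expand[OF t, of x x]
    by (simp add: sum.distrib mult.commute)
  have 1: "(LINT x|lborel. \<Phi> t x * divergence ?F x) =
      - (LINT x|lborel. (\<Sum>j\<in>UNIV. ?F x $ j * \<Phi>x t x (e j)))"
    by (rule parts; use r t in \<open>auto intro!: continuous_intros space_cont\<close>)
  also have "\<dots> = - virial t"
    unfolding virial_def by (subst \<Phi>x_expand[OF t]) (simp add: sum_distrib_left mult.assoc)
  finally have "virial t = - (LINT x|lborel. \<rho>x t x x * \<Phi> t x + real CARD('n) * (\<rho> t x * \<Phi> t x))"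
    unfolding div by (simp add: algebra_simps)
  moreover have "integrable lborel (\<lambda>x. \<rho> t x * \<Phi> t x)"
    by (intro integrable_\<rho> t space_cont)
  moreover have "integrable lborel (\<lambda>x. \<rho>x t x x * \<Phi> t x)"
  proof (rule integrable_compact_support[of _ r])
    show "continuous_on UNIV (\<lambda>x. \<rho>x t x x * \<Phi> t x)"
      by (subst \<rho>x_expand[OF t]) (intro continuous_intros space_cont t)
    show "\<rho>x t x x * \<Phi> t x = 0" if "norm x > r" for x
      using has_partial_support[OF \<rho>_partial[OF t] _ that] r t by (subst \<rho>x_expand[OF t]) auto
  qed
  ultimately show ?thesis
    by (simp add: newton_form_def self_energy_def newton_eq_potential)
qed

text \<open>The scaling law contributes (N + 2) / 2 and the divergence of x contributes -N, in total
  -(N - 2) / 2.\<close>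

lemma virial_eq:
  assumes t: "t \<ge> 0" and card3: "CARD('n) \<ge> 3"
  shows "virial t = - (real CARD('n) - 2) / 2 * self_energy t"
proof -
  obtain r where r: "\<forall>s\<in>{0..t}. \<forall>x. norm x > r \<longrightarrow> \<rho> s x = 0" using support ..
  have "2 * newton_form (\<lambda>x. \<rho>x t x x) (\<rho> t) = - (real CARD('n) + 2) * self_energy t"
    unfolding self_energy_def
    by (rule newton_form_virial[OF card3 \<rho>_space[OF t], of r]) (use r t in \<open>auto intro: space_cont\<close>)
  then show ?thesis using virial_eq_newton_form[OF t] by (simp add: field_simps)
qed

text \<open>For N = 2 the two multiples of the self-energy cancel, and only the logarithmic term
  survives.\<close>

lemma virial_eq_2:
  assumes t: "t \<ge> 0" and card2: "CARD('n) = 2"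
  shows "virial t = (total_mass t)\<^sup>2 / 2"
proof -
  obtain r where r: "\<forall>s\<in>{0..t}. \<forall>x. norm x > r \<longrightarrow> \<rho> s x = 0" using support ..
  have "2 * newton_form (\<lambda>x. \<rho>x t x x) (\<rho> t) = - 4 * self_energy t - (total_mass t)\<^sup>2"
    unfolding self_energy_def total_mass_def
    by (rule newton_form_virial_2[OF card2 \<rho>_space[OF t], of r]) (use r t in \<open>auto intro: space_cont\<close>)
  then show ?thesis using virial_eq_newton_form[OF t] card2 by simp
qed

lemma self_energy_nonpos:
  assumes t: "t \<ge> 0" and "CARD('n) \<ge> 3"
  shows "self_energy t \<le> 0"
proof -
  have "newton (\<rho> t) x \<le> 0" for x
  proof -
    have "0 \<le> (LINT y|lborel. - (G (x - y) * \<rho> t y))"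
      by (rule Bochner_Integration.integral_nonneg)
         (use assms(2) \<rho>_nonneg[OF t] in \<open>auto simp: G_def\<close>)
    then show ?thesis by (simp add: newton_def)
  qed
  then have "0 \<le> (LINT x|lborel. - (\<rho> t x * newton (\<rho> t) x))"
    by (intro Bochner_Integration.integral_nonneg) (auto simp: mult_nonneg_nonpos \<rho>_nonneg[OF t])
  then show ?thesis by (simp add: self_energy_def newton_form_def)
qed

text \<open>Only the forces work on the fluid: the transport terms of the momentum equation tested
  with u_i cancel those of the continuity equation tested with u . u.\<close>

lemma kinetic_deriv:
  assumes t: "t \<ge> 0"
  shows "(kinetic has_real_derivative
      2 * (LINT x|lborel. \<rho> t x * \<Phi>x t x (u t x)) - 2 * (\<Sum>i\<in>UNIV. LINT x|lborel. u t x $ i * Px i t x))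
      (at t within {0..})"
proof -
  obtain r where r: "\<forall>s\<in>{0..t+1}. \<forall>x. norm x > r \<longrightarrow> \<rho> s x = 0" using support ..
  \<comment> \<open>The derivative of \<rho> |u|^2 is arranged as 2 u . (\<rho> u)_t - |u|^2
    \<rho>_t, so that only the conserved densities are differentiated in time.\<close>
  let ?g' = "\<lambda>t x. 2 * (\<Sum>i\<in>UNIV. u t x $ i * mt i t x) - (u t x \<bullet> u t x) * \<rho>t t x"
  have "(kinetic has_real_derivative (LINT x|lborel. ?g' t x)) (at t within {0..})"
    unfolding kinetic_def
  proof (rule time_derivative_LINT[OF t, where r = r])
    fix s x assume s: "(s::real) \<ge> 0"
    have "((\<lambda>s. \<Sum>i\<in>UNIV. (\<rho> s x * u s x $ i) * u s x $ i) has_real_derivative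
        (\<Sum>i\<in>UNIV. mt i s x * u s x $ i + ut s x $ i * (\<rho> s x * u s x $ i))) (at s within {0..})"
      by (intro DERIV_sum DERIV_mult momentum_time u_nth_time s)
    also have "(\<lambda>s. \<Sum>i\<in>UNIV. (\<rho> s x * u s x $ i) * u s x $ i) = (\<lambda>s. \<rho> s x * (u s x \<bullet> u s x))"
      by (simp add: inner_vec_def sum_distrib_left mult_ac)
    also have "(\<Sum>i\<in>UNIV. mt i s x * u s x $ i + ut s x $ i * (\<rho> s x * u s x $ i)) = ?g' s x"
      unfolding inner_vec_def sum_distrib_left sum_distrib_right sum_subtractf[symmetric]
      by (rule sum.cong) (auto simp: mt_def algebra_simps)
    finally show "((\<lambda>s. \<rho> s x * (u s x \<bullet> u s x)) has_real_derivative ?g' s x) (at s within {0..})" .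
  qed (use r in \<open>auto intro!: continuous_intros joint_cont momentum_cont\<close>)
  moreover have "(LINT x|lborel. ?g' t x) = 2 * (LINT x|lborel. \<rho> t x * \<Phi>x t x (u t x))
      - 2 * (\<Sum>i\<in>UNIV. LINT x|lborel. u t x $ i * Px i t x)"
  proof -
    let ?T = "\<lambda>i j x. \<rho> t x * (u t x $ i * u t x $ j * ux t x (e j) $ i)"
    have iT: "integrable lborel (?T i j)" for i j
      by (intro integrable_\<rho> t continuous_intros space_cont)
    have iF: "integrable lborel (\<lambda>x. \<rho> t x * (u t x $ i * \<Phi>x t x (e i)))" for i
    proof -
      show ?thesis by (intro integrable_\<rho> t continuous_intros space_cont)
    qed
    have cu: "continuous_on UNIV (\<lambda>x. u t x $ i)" "continuous_on UNIV (\<lambda>x. ux t x (e j) $ i)" for i j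
      by (intro continuous_intros space_cont t)+
    note mw = momentum_weak[OF t u_partial[OF t] cu]
    have m: "(LINT x|lborel. u t x $ i * mt i t x) = (\<Sum>j\<in>UNIV. LINT x|lborel. ?T i j x)
        - (LINT x|lborel. u t x $ i * Px i t x) + (LINT x|lborel. \<rho> t x * (u t x $ i * \<Phi>x t x (e i)))" for i
      using iT by (simp add: mw(2) Bochner_Integration.integral_sum mult.assoc)
    have uu: "has_partial j (\<lambda>x. u t x \<bullet> u t x) (\<lambda>x. \<Sum>i\<in>UNIV. ux t x (e j) $ i * u t x $ i + u t x $ i * ux t x (e j) $ i)" for j
      unfolding inner_vec_def inner_real_def
      by (intro has_partial_sum has_partial_mult u_partial[OF t])
    have c2: "continuous_on UNIV (\<lambda>x. u t x \<bullet> u t x)"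
      "continuous_on UNIV (\<lambda>x. \<Sum>i\<in>UNIV. ux t x (e j) $ i * u t x $ i + u t x $ i * ux t x (e j) $ i)" for j
      by (intro continuous_intros space_cont t)+
    note cw = continuity_weak[OF t uu c2]
    have "(LINT x|lborel. (u t x \<bullet> u t x) * \<rho>t t x) =
        (LINT x|lborel. (\<Sum>j\<in>UNIV. \<Sum>i\<in>UNIV. 2 * ?T i j x))"
      unfolding cw(2) by (simp add: sum_distrib_left algebra_simps)
    also have "\<dots> = (\<Sum>j\<in>UNIV. \<Sum>i\<in>UNIV. 2 * (LINT x|lborel. ?T i j x))"
      using iT by (simp add: Bochner_Integration.integral_sum)
    also have "\<dots> = 2 * (\<Sum>i\<in>UNIV. \<Sum>j\<in>UNIV. LINT x|lborel. ?T i j x)"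
      by (subst sum.swap) (simp add: sum_distrib_left)
    finally have uuT: "(LINT x|lborel. (u t x \<bullet> u t x) * \<rho>t t x) = 2 * (\<Sum>i\<in>UNIV. \<Sum>j\<in>UNIV. LINT x|lborel. ?T i j x)" .
    have F: "(LINT x|lborel. \<rho> t x * \<Phi>x t x (u t x)) = (\<Sum>i\<in>UNIV. LINT x|lborel. \<rho> t x * (u t x $ i * \<Phi>x t x (e i)))"
      using iF by (subst \<Phi>x_expand[OF t]) (simp add: sum_distrib_left Bochner_Integration.integral_sum)
    have "(LINT x|lborel. ?g' t x) = 2 * (\<Sum>i\<in>UNIV. LINT x|lborel. u t x $ i * mt i t x)
        - (LINT x|lborel. (u t x \<bullet> u t x) * \<rho>t t x)"
      using mw(1) cw(1) by (simp add: Bochner_Integration.integral_sum)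
    then show ?thesis
      unfolding uuT m F by (simp add: sum.distrib sum_subtractf algebra_simps)
  qed
  ultimately show ?thesis by simp
qed

text \<open>The continuity equation gives P_t = - u . grad P - \<gamma> P div u, and integrating the
  last term by parts leaves \<gamma> - 1 times the work of the pressure. This factor explains the
  weight 1/(\<gamma> - 1) in the energy.\<close>

lemma total_pressure_deriv:
  assumes t: "t \<ge> 0"
  shows "(total_pressure has_real_derivative
      (\<gamma> - 1) * (\<Sum>i\<in>UNIV. LINT x|lborel. u t x $ i * Px i t x)) (at t within {0..})"
proof -
  obtain r where r: "\<forall>s\<in>{0..t+1}. \<forall>x. norm x > r \<longrightarrow> \<rho> s x = 0" using support ..
  have "(total_pressure has_real_derivative (LINT x|lborel. K * \<gamma> * \<rho> t x powr (\<gamma> - 1) * \<rho>t t x)) (at t within {0..})"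
    unfolding total_pressure_def
  proof (rule time_derivative_LINT[OF t P_time, where r = r])
    show "continuous_on ({0..} \<times> UNIV) (\<lambda>p. P (fst p) (snd p))"
      unfolding pressure_def
      by (intro continuous_intros continuous_on_powr_const joint_cont) (use \<rho>_nonneg \<gamma> in auto)
    show "continuous_on ({0..} \<times> UNIV)
        (\<lambda>p. K * \<gamma> * \<rho> (fst p) (snd p) powr (\<gamma> - 1) * \<rho>t (fst p) (snd p))"
      by (intro continuous_intros continuous_on_powr_const joint_cont) (use \<rho>_nonneg \<gamma> in auto)
  qed (use r in \<open>auto simp: pressure_def\<close>)
  moreover have "(LINT x|lborel. K * \<gamma> * \<rho> t x powr (\<gamma> - 1) * \<rho>t t x) =
      (\<gamma> - 1) * (\<Sum>i\<in>UNIV. LINT x|lborel. u t x $ i * Px i t x)"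
  proof -
    have div: "divergence (\<lambda>y. \<rho> t y *\<^sub>R u t y) x =
        (\<Sum>j\<in>UNIV. \<rho>x t x (e j) * u t x $ j + \<rho> t x * ux t x (e j) $ j)" for x
      unfolding divergence_def
      using has_partial_imp_partial[OF has_partial_mult[OF \<rho>_partial[OF t] u_partial[OF t]]] by simp
    have pw: "\<rho> t x powr (\<gamma> - 1) * \<rho> t x = \<rho> t x powr \<gamma>" for x
      using \<rho>_nonneg[OF t, of x] by (cases "\<rho> t x = 0") (auto simp: powr_diff)
    have eq: "K * \<gamma> * \<rho> t x powr (\<gamma> - 1) * \<rho>t t x =
        (\<Sum>j\<in>UNIV. - (u t x $ j * Px j t x) - \<gamma> * (P t x * ux t x (e j) $ j))" for x
      unfolding \<rho>t_eq[OF t] div sum_negf[symmetric] sum_distrib_left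
      by (rule sum.cong) (auto simp: Px_def pressure_def pw[symmetric] algebra_simps)
    have cu: "continuous_on UNIV (\<lambda>x. u t x $ i)" "continuous_on UNIV (\<lambda>x. ux t x (e j) $ i)" for i j
      by (intro continuous_intros space_cont t)+
    note pr = pressure_weak[OF t u_partial[OF t] cu(1) cu(2)]
    have iP: "integrable lborel (\<lambda>x. P t x * ux t x (e j) $ j)" for j
      by (intro integrable_P t cu)
    have "(LINT x|lborel. K * \<gamma> * \<rho> t x powr (\<gamma> - 1) * \<rho>t t x) =
      (\<Sum>j\<in>UNIV. - (LINT x|lborel. u t x $ j * Px j t x) - \<gamma> * (LINT x|lborel. P t x * ux t x (e j) $ j))"
      unfolding eq using pr(1) iP by (simp add: Bochner_Integration.integral_sum)
    also have "\<dots> = (\<Sum>j\<in>UNIV. (\<gamma> - 1) * (LINT x|lborel. u t x $ j * Px j t x))"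
      by (rule sum.cong) (auto simp: pr(2) algebra_simps)
    finally show ?thesis by (simp add: sum_distrib_left)
  qed
  ultimately show ?thesis by simp
qed

text \<open>The product rule for the form along the time evolution of \<rho>, followed by the
  continuity equation tested with \<Phi>.\<close>

lemma self_energy_deriv:
  assumes t: "t \<ge> 0"
  shows "(self_energy has_real_derivative 2 * (LINT x|lborel. \<rho> t x * \<Phi>x t x (u t x))) (at t within {0..})"
proof -
  obtain r where r: "\<forall>s\<in>{0..t+1}. \<forall>x. norm x > r \<longrightarrow> \<rho> s x = 0" using support ..
  have "(self_energy has_real_derivative 2 * newton_form (\<rho>t t) (\<rho> t)) (at t within {0..t + 1})"
    unfolding self_energy_def
  proof (rule has_real_derivative_newton_form[OF card, where r = r])
    show "((\<lambda>s. \<rho> s x) has_real_derivative \<rho>t s x) (at s within {0..t + 1})" if "s \<in> {0..t+1}" for s x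
      using that by (intro has_field_derivative_subset[OF \<rho>_time]) auto
    show "continuous_on UNIV (\<rho> s)" if "s \<in> {0..t+1}" for s
      using space_cont(1)[of s] that by simp
    show "continuous_on ({0..t + 1} \<times> UNIV) (\<lambda>(s, x). \<rho>t s x)"
      unfolding split_beta by (rule continuous_on_subset[OF \<rho>t_cont]) auto
    have F: "has_partial j (\<lambda>y. \<rho> t y * u t y $ j) (\<lambda>x. \<rho>x t x (e j) * u t x $ j + \<rho> t x * ux t x (e j) $ j)" for j
      by (intro has_partial_mult \<rho>_partial u_partial t)
    show "\<rho>t t x = 0" if "norm x > r" for x
      unfolding \<rho>t_eq[OF t] divergence_def
      using has_partial_imp_partial[OF F] has_partial_support[OF F _ that] r t by simp
  qed (use t r in auto)
  moreover have "newton_form (\<rho>t t) (\<rho> t) = (LINT x|lborel. \<rho> t x * \<Phi>x t x (u t x))"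
  proof -
    have "newton_form (\<rho>t t) (\<rho> t) = (LINT x|lborel. \<Phi> t x * \<rho>t t x)"
      by (simp add: newton_form_def newton_eq_potential mult.commute)
    also have "\<dots> = (LINT x|lborel. (\<Sum>j\<in>UNIV. \<rho> t x * u t x $ j * \<Phi>x t x (e j)))"
      by (intro continuity_weak(2) t \<Phi>_partial space_cont)
    also have "\<dots> = (LINT x|lborel. \<rho> t x * \<Phi>x t x (u t x))"
      by (subst (2) \<Phi>x_expand[OF t]) (simp add: sum_distrib_left mult.assoc)
    finally show ?thesis .
  qed
  ultimately show ?thesis using at_within_Icc_eq_Ici[of t "t + 1" 0] by simp
qed

section \<open>Conserved quantities and signs of the integrals\<close>

lemma total_mass_constant: "s \<ge> 0 \<Longrightarrow> t \<ge> 0 \<Longrightarrow> total_mass s = total_mass t"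
  by (rule constant_from_zero_derivative[OF total_mass_deriv])

lemma total_energy_deriv:
  assumes t: "t \<ge> 0"
  shows "(total_energy has_real_derivative 0) (at t within {0..})"
  unfolding total_energy_def
  using kinetic_deriv[OF t] total_pressure_deriv[OF t] self_energy_deriv[OF t] \<gamma>
  by (auto intro!: derivative_eq_intros simp: field_simps)

lemma total_energy_constant: "s \<ge> 0 \<Longrightarrow> t \<ge> 0 \<Longrightarrow> total_energy s = total_energy t"
  by (rule constant_from_zero_derivative[OF total_energy_deriv])

lemma kinetic_nonneg: "t \<ge> 0 \<Longrightarrow> kinetic t \<ge> 0"
  unfolding kinetic_def by (intro Bochner_Integration.integral_nonneg) (simp add: \<rho>_nonneg)

lemma inertia_nonneg: "t \<ge> 0 \<Longrightarrow> inertia t \<ge> 0"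
  unfolding inertia_def by (intro Bochner_Integration.integral_nonneg) (simp add: \<rho>_nonneg)

lemma total_pressure_nonneg: "t \<ge> 0 \<Longrightarrow> total_pressure t \<ge> 0"
  unfolding total_pressure_def pressure_def by (intro Bochner_Integration.integral_nonneg) (simp add: K)

lemma total_mass_nonneg: "t \<ge> 0 \<Longrightarrow> total_mass t \<ge> 0"
  unfolding total_mass_def by (intro Bochner_Integration.integral_nonneg) (simp add: \<rho>_nonneg)

text \<open>Nonnegativity of \<open>\<integral> \<rho> |u - a x|\<^sup>2\<close> at \<open>a = radial_momentum t / (inertia t + 1)\<close>; the summand \<open>1\<close>
  avoids a division by zero.\<close>

lemma radial_momentum_bound:
  assumes t: "t \<ge> 0"
  shows "(radial_momentum t)\<^sup>2 \<le> (inertia t + 1) * kinetic t"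
proof -
  let ?I = "inertia t + 1"
  define a where "a = radial_momentum t / ?I"
  have I: "?I > 0" using inertia_nonneg[OF t] by simp
  have int: "integrable lborel (\<lambda>x. \<rho> t x * (x \<bullet> x))" "integrable lborel (\<lambda>x. \<rho> t x * (x \<bullet> u t x))"
    "integrable lborel (\<lambda>x. \<rho> t x * (u t x \<bullet> u t x))"
    by (intro integrable_\<rho> t continuous_intros space_cont)+
  have "0 \<le> (LINT x|lborel. \<rho> t x * ((u t x - a *\<^sub>R x) \<bullet> (u t x - a *\<^sub>R x)))"
    by (intro Bochner_Integration.integral_nonneg) (simp add: \<rho>_nonneg t)
  also have "\<dots> = (LINT x|lborel. \<rho> t x * (u t x \<bullet> u t x) - 2 * a * (\<rho> t x * (x \<bullet> u t x)) + a\<^sup>2 * (\<rho> t x * (x \<bullet> x)))"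
    by (intro Bochner_Integration.integral_cong)
       (auto simp: inner_diff_left inner_diff_right inner_commute algebra_simps power2_eq_square)
  also have "\<dots> = kinetic t - 2 * a * radial_momentum t + a\<^sup>2 * inertia t"
    using int by (simp add: kinetic_def radial_momentum_def inertia_def)
  also have "\<dots> \<le> kinetic t - 2 * a * radial_momentum t + a\<^sup>2 * ?I"
    by (simp add: algebra_simps)
  also have "\<dots> = kinetic t - (radial_momentum t)\<^sup>2 / ?I"
    using I by (simp add: a_def power2_eq_square divide_simps)
  finally show ?thesis using I by (simp add: divide_simps mult.commute split: if_splits)
qed

end

section \<open>Spreading of the support\<close>

text \<open>The joint derivative on the half space is restricted to the lines of constant x and the
  slices of constant t.\<close>

lemma C1_on_atLeast_0_times_UNIV:
  fixes f :: "real \<Rightarrow> 'a::euclidean_space \<Rightarrow> 'b::real_normed_vector"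
  assumes "C1_on (\<lambda>(t, x). f t x) ({0..} \<times> UNIV)"
  shows "\<exists>ft fx. (\<forall>t\<ge>0. \<forall>x. ((\<lambda>s. f s x) has_vector_derivative ft t x) (at t within {0..})) \<and>
    (\<forall>t\<ge>0. \<forall>x. (f t has_derivative fx t x) (at x)) \<and>
    continuous_on ({0..} \<times> UNIV) (\<lambda>p. f (fst p) (snd p)) \<and>
    continuous_on ({0..} \<times> UNIV) (\<lambda>p. ft (fst p) (snd p)) \<and>
    (\<forall>v. continuous_on ({0..} \<times> UNIV) (\<lambda>p. fx (fst p) (snd p) v))"
proof -
  let ?S = "{0::real..} \<times> (UNIV :: 'a set)" and ?f = "\<lambda>(t, x). f t x"
  obtain f' where f': "\<And>p. p \<in> ?S \<Longrightarrow> (?f has_derivative blinfun_apply (f' p)) (at p within ?S)"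
    and cont: "continuous_on ?S f'"
    using assms unfolding C1_on_def by blast
  have app: "continuous_on ?S (\<lambda>p. blinfun_apply (f' p) v)" for v
    by (intro continuous_intros cont)
  show ?thesis
  proof (intro exI[of _ "\<lambda>t x. blinfun_apply (f' (t, x)) (1, 0)"]
      exI[of _ "\<lambda>t x v. blinfun_apply (f' (t, x)) (0, v)"] conjI allI impI)
    fix t :: real and x :: 'a assume t: "t \<ge> 0"
    have "((\<lambda>s. ?f (s, x)) has_derivative (\<lambda>h. blinfun_apply (f' (t, x)) (h, 0))) (at t within {0..})"
      by (rule has_derivative_in_compose2[where t = ?S, OF f'])
         (use t in \<open>auto intro!: derivative_eq_intros\<close>)
    moreover have "(\<lambda>h. blinfun_apply (f' (t, x)) (h, 0)) = (\<lambda>h. h *\<^sub>R blinfun_apply (f' (t, x)) (1, 0))"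
      by (rule ext) (simp flip: blinfun.scaleR_right)
    ultimately show "((\<lambda>s. f s x) has_vector_derivative blinfun_apply (f' (t, x)) (1, 0)) (at t within {0..})"
      by (simp only: has_vector_derivative_def prod.case)
  next
    fix t :: real and x :: 'a assume t: "t \<ge> 0"
    have "((\<lambda>y. ?f (t, y)) has_derivative (\<lambda>v. blinfun_apply (f' (t, x)) (0, v))) (at x within UNIV)"
      by (rule has_derivative_in_compose2[where t = ?S, OF f'])
         (use t in \<open>auto intro!: derivative_eq_intros\<close>)
    then show "(f t has_derivative (\<lambda>v. blinfun_apply (f' (t, x)) (0, v))) (at x)" by simp
  next
    show "continuous_on ?S (\<lambda>p. f (fst p) (snd p))"
      unfolding continuous_on_eq_continuous_within
      using has_derivative_continuous[OF f'] unfolding case_prod_unfold by blast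
  qed (use app in auto)
qed

context euler_poisson_flow
begin

lemma inertia_le:
  assumes t: "t \<ge> 0" and R: "\<And>x. \<rho> t x \<noteq> 0 \<Longrightarrow> norm x \<le> R"
  shows "inertia t \<le> total_mass t * R\<^sup>2"
proof -
  have int: "integrable lborel (\<lambda>x. \<rho> t x * (x \<bullet> x))" "integrable lborel (\<lambda>x. \<rho> t x * R\<^sup>2)"
    by (intro integrable_\<rho> t continuous_intros)+
  have "inertia t \<le> (LINT x|lborel. \<rho> t x * R\<^sup>2)"
    unfolding inertia_def
  proof (rule integral_mono[OF int])
    show "\<rho> t x * (x \<bullet> x) \<le> \<rho> t x * R\<^sup>2" for x
    proof (cases "\<rho> t x = 0")
      case False
      have "x \<bullet> x = (norm x)\<^sup>2" by (simp add: power2_norm_eq_inner)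
      also have "\<dots> \<le> R\<^sup>2" using R[OF False] by (intro power_mono) auto
      finally show ?thesis by (intro mult_left_mono \<rho>_nonneg t)
    qed simp
  qed
  then show ?thesis by (simp add: total_mass_def)
qed

text \<open>Jensen's inequality on \<open>S\<close>, obtained by integrating the tangent inequality
  at the mean density.\<close>

lemma total_pressure_lower_bound:
  assumes t: "t \<ge> 0" and M: "total_mass t > 0" and S: "compact S" "\<And>x. \<rho> t x \<noteq> 0 \<Longrightarrow> x \<in> S"
  shows "K * total_mass t powr \<gamma> / measure lborel S powr (\<gamma> - 1) \<le> total_pressure t"
proof -
  let ?M = "total_mass t" and ?V = "measure lborel S" and ?i = "indicator S :: _ \<Rightarrow> real"
  have Sm: "S \<in> sets lborel" "emeasure lborel S < \<infinity>"
    using borel_compact[OF S(1)] emeasure_bounded_finite[OF compact_imp_bounded[OF S(1)]] by auto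
  have iS: "integrable lborel ?i" by (rule integrable_real_indicator[OF Sm])
  have int: "integrable lborel (\<rho> t)" "integrable lborel (\<lambda>x. \<rho> t x powr \<gamma>)"
  proof -
    show "integrable lborel (\<rho> t)" using integrable_\<rho>[OF t continuous_on_const, of 1] by simp
    obtain r where r: "\<forall>s\<in>{0..t}. \<forall>x. norm x > r \<longrightarrow> \<rho> s x = 0" using support ..
    show "integrable lborel (\<lambda>x. \<rho> t x powr \<gamma>)"
      by (rule integrable_compact_support[of _ r])
         (use r t \<gamma> \<rho>_nonneg in \<open>auto intro!: continuous_on_powr_const space_cont\<close>)
  qed
  \<comment> \<open>A null set \<open>S\<close> would carry no mass.\<close>
  have V: "?V > 0"
  proof (rule ccontr)
    assume "\<not> ?V > 0"
    then have "?V = 0" using measure_nonneg[of lborel S] by linarith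
    then have "S \<in> null_sets lborel" using Sm by (auto simp: measure_eq_0_null_sets emeasure_eq_ennreal_measure)
    then have "AE x in lborel. x \<notin> S" by (rule AE_not_in)
    then have "AE x in lborel. \<rho> t x = 0" by eventually_elim (use S(2) in blast)
    then have "?M = 0" unfolding total_mass_def by (simp add: integral_eq_zero_AE)
    with M show False by simp
  qed
  define m where "m = ?M / ?V"
  have m: "m > 0" using M V by (simp add: m_def)
  \<comment> \<open>The integrand is the tangent at \<open>m\<close> on \<open>S\<close> and 0
    outside. Its linear parts cancel in the integral, since \<open>m * ?V = ?M\<close>.\<close>
  have "m powr \<gamma> * ?V = (LINT x|lborel. (m powr \<gamma> - \<gamma> * m powr (\<gamma> - 1) * m) * ?i x + \<gamma> * m powr (\<gamma> - 1) * \<rho> t x)"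
    using iS int V by (simp add: total_mass_def[symmetric] m_def algebra_simps)
  also have "\<dots> \<le> (LINT x|lborel. \<rho> t x powr \<gamma>)"
  proof (rule integral_mono)
    show "(m powr \<gamma> - \<gamma> * m powr (\<gamma> - 1) * m) * ?i x + \<gamma> * m powr (\<gamma> - 1) * \<rho> t x \<le> \<rho> t x powr \<gamma>" for x
    proof (cases "x \<in> S")
      case True
      then show ?thesis
        using powr_tangent[OF \<rho>_nonneg[OF t] m \<gamma>, of x] by (simp add: algebra_simps)
    next
      case False
      then have "\<rho> t x = 0" using S(2) by blast
      then show ?thesis using False by simp
    qed
  qed (use iS int in auto)
  finally have "K * (m powr \<gamma> * ?V) \<le> K * (LINT x|lborel. \<rho> t x powr \<gamma>)"
    using K by (rule mult_left_mono)
  also have "\<dots> = total_pressure t" by (simp add: total_pressure_def pressure_def)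
  also have "m powr \<gamma> * ?V = ?M powr \<gamma> / ?V powr (\<gamma> - 1)"
    using M V by (simp add: m_def powr_divide powr_diff)
  finally show ?thesis by simp
qed

lemma virial_nonneg:
  assumes t: "t \<ge> 0"
  shows "virial t \<ge> 0"
proof (cases "CARD('n) = 2")
  case False
  then have c: "CARD('n) \<ge> 3" using card by simp
  then have "(real CARD('n) - 2) * self_energy t \<le> 0"
    using self_energy_nonpos[OF t c] by (intro mult_nonneg_nonpos) auto
  then show ?thesis unfolding virial_eq[OF t c] by linarith
qed (simp add: virial_eq_2[OF t])

text \<open>The two sides are compared summand by summand. The ratios of the weights are 2 for the
  kinetic part, N (\<gamma> - 1) for the pressure and N - 2 for the self-energy; since all three
  parts of the energy are nonnegative, the smallest ratio works for the sum.\<close>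

lemma total_energy_le_virial:
  assumes t: "t \<ge> 0" and c: "CARD('n) \<ge> 3"
  shows "Min {2, real CARD('n) * (\<gamma> - 1), real CARD('n) - 2} * total_energy t
    \<le> kinetic t + real CARD('n) * total_pressure t + virial t"
proof -
  define \<kappa> where "\<kappa> = Min {2, real CARD('n) * (\<gamma> - 1), real CARD('n) - 2}"
  have \<kappa>: "\<kappa> \<le> 2" "\<kappa> \<le> real CARD('n) * (\<gamma> - 1)" "\<kappa> \<le> real CARD('n) - 2"
    unfolding \<kappa>_def by (rule Min_le; simp)+
  have "\<kappa> * (kinetic t / 2) \<le> 2 * (kinetic t / 2)"
    using \<kappa>(1) kinetic_nonneg[OF t] by (intro mult_right_mono) auto
  moreover have "\<kappa> * (total_pressure t / (\<gamma> - 1)) \<le> real CARD('n) * (\<gamma> - 1) * (total_pressure t / (\<gamma> - 1))"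
    using \<kappa>(2) total_pressure_nonneg[OF t] \<gamma> by (intro mult_right_mono) auto
  moreover have "\<kappa> * (- self_energy t / 2) \<le> (real CARD('n) - 2) * (- self_energy t / 2)"
    using \<kappa>(3) self_energy_nonpos[OF t c] by (intro mult_right_mono) auto
  moreover have "real CARD('n) * (\<gamma> - 1) * (total_pressure t / (\<gamma> - 1)) = real CARD('n) * total_pressure t"
    using \<gamma> by simp
  moreover have "virial t = (real CARD('n) - 2) * (- self_energy t / 2)"
    unfolding virial_eq[OF t c] by (simp add: field_simps)
  moreover have "\<kappa> * total_energy t =
      \<kappa> * (kinetic t / 2) + \<kappa> * (total_pressure t / (\<gamma> - 1)) + \<kappa> * (- self_energy t / 2)"
    by (simp add: total_energy_def right_diff_distrib distrib_left)
  ultimately show ?thesis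
    unfolding \<kappa>_def[symmetric] by linarith
qed

end

theorem theorem4:
  fixes \<rho> :: "real \<Rightarrow> real^'n \<Rightarrow> real"
    and u :: "real \<Rightarrow> real^'n \<Rightarrow> real^'n"
    and \<Omega> :: "real \<Rightarrow> (real^'n) set"
    and K \<gamma> t0 M E :: real
  assumes "CARD('n) \<ge> 2"
    and "K \<ge> 0"
    and "\<gamma> > 1"
    and "euler_poisson_global_classical K \<gamma> \<rho> u"
    and "compactly_supported_in \<rho> \<Omega>"
    and "t0 \<ge> 0"
    and "M = mass \<Omega> \<rho> t0"
    and "E = energy K \<gamma> \<Omega> \<rho> u t0"
  shows "(CARD('n) \<ge> 3 \<longrightarrow>
            Liminf at_top (\<lambda>t. ereal (radius \<Omega> t / t))
              \<ge> ereal (sqrt (Min {2, real CARD('n) * (\<gamma> - 1), real CARD('n) - 2} * E / M)))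
       \<and> (CARD('n) = 2 \<longrightarrow>
            Liminf at_top (\<lambda>t. ereal (radius \<Omega> t / t)) \<ge> ereal (sqrt (1 / (2 * M))))
       \<and> (\<forall>V. (\<forall>t\<ge>0. measure lborel (\<Omega> t) = V) \<longrightarrow>
            Liminf at_top (\<lambda>t. ereal (radius \<Omega> t / t))
              \<ge> ereal (sqrt (real CARD('n) * K * M powr (\<gamma> - 1) / V powr (\<gamma> - 1))))"
proof -
  note ep = assms(4)[unfolded euler_poisson_global_classical_def]
  have c1: "C1_on (\<lambda>(t, x). \<rho> t x) ({0..} \<times> UNIV)" "C1_on (\<lambda>(t, x). u t x) ({0..} \<times> UNIV)"
    using conjunct1[OF ep] conjunct1[OF conjunct2[OF ep]] .
  obtain \<rho>t \<rho>x where \<rho>: "\<forall>t\<ge>0. \<forall>x. ((\<lambda>s. \<rho> s x) has_vector_derivative \<rho>t t x) (at t within {0..})"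
    "\<forall>t\<ge>0. \<forall>x. (\<rho> t has_derivative \<rho>x t x) (at x)"
    "continuous_on ({0..} \<times> UNIV) (\<lambda>p. \<rho> (fst p) (snd p))"
    "continuous_on ({0..} \<times> UNIV) (\<lambda>p. \<rho>t (fst p) (snd p))"
    "\<forall>v. continuous_on ({0..} \<times> UNIV) (\<lambda>p. \<rho>x (fst p) (snd p) v)"
    using C1_on_atLeast_0_times_UNIV[OF c1(1)] by (elim exE conjE) (rule that)
  obtain ut ux where u: "\<forall>t\<ge>0. \<forall>x. ((\<lambda>s. u s x) has_vector_derivative ut t x) (at t within {0..})"
    "\<forall>t\<ge>0. \<forall>x. (u t has_derivative ux t x) (at x)"
    "continuous_on ({0..} \<times> UNIV) (\<lambda>p. u (fst p) (snd p))"
    "continuous_on ({0..} \<times> UNIV) (\<lambda>p. ut (fst p) (snd p))"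
    "\<forall>v. continuous_on ({0..} \<times> UNIV) (\<lambda>p. ux (fst p) (snd p) v)"
    using C1_on_atLeast_0_times_UNIV[OF c1(2)] by (elim exE conjE) (rule that)
  have "\<forall>t\<in>{0..}. \<exists>\<Phi>'. (\<forall>x. (potential \<rho> t has_derivative blinfun_apply (\<Phi>' x)) (at x)) \<and> continuous_on UNIV \<Phi>'"
    using ep by (auto simp: C1_on_def)
  then obtain \<Phi>' where \<Phi>': "\<And>t x. t \<ge> 0 \<Longrightarrow> (potential \<rho> t has_derivative blinfun_apply (\<Phi>' t x)) (at x)"
    "\<And>t. t \<ge> 0 \<Longrightarrow> continuous_on UNIV (\<Phi>' t)"
    by (metis atLeast_iff)
  have supp: "\<exists>r. \<forall>t\<in>{0..T}. \<forall>x. norm x > r \<longrightarrow> \<rho> t x = 0" for T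
  proof -
    have "bounded (\<Union>t\<in>{0..T}. {x. \<rho> t x \<noteq> 0})" using assms(5) by (simp add: compactly_supported_in_def)
    then obtain r where "\<forall>x\<in>(\<Union>t\<in>{0..T}. {x. \<rho> t x \<noteq> 0}). norm x \<le> r" unfolding bounded_iff by blast
    then show ?thesis by (intro exI[of _ r]) (auto simp: not_le[symmetric])
  qed
  interpret euler_poisson_flow K \<gamma> \<rho> \<rho>t \<rho>x u ut ux "\<lambda>t x. blinfun_apply (\<Phi>' t x)"
  proof
    show "((\<lambda>s. \<rho> s x) has_real_derivative \<rho>t t x) (at t within {0..})" if "t \<ge> 0" for t x
      using \<rho>(1) that by (simp add: has_real_derivative_iff_has_vector_derivative)
    show "continuous_on UNIV (\<lambda>x. blinfun_apply (\<Phi>' t x) v)" if "t \<ge> 0" for t v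
      by (intro continuous_intros \<Phi>' that)
    show "0 \<le> \<rho> t x" if "t \<ge> 0" for t x using ep that by blast
    show "time_deriv (\<lambda>s. \<rho> s x) t + divergence (\<lambda>y. \<rho> t y *\<^sub>R u t y) x = 0" if "t \<ge> 0" for t x
      using ep that by blast
    show "time_deriv (\<lambda>s. \<rho> s x * u s x $ i) t + divergence (\<lambda>y. (\<rho> t y * u t y $ i) *\<^sub>R u t y) x
        + partial i (pressure K \<gamma> \<rho> t) x = \<rho> t x * partial i (potential \<rho> t) x" if "t \<ge> 0" for t x i
      using ep that by blast
  qed (use assms \<rho> u \<Phi>' supp in auto)
  have \<Omega>: "compact (\<Omega> t)" "\<Omega> t \<noteq> {}" "\<And>x. \<rho> t x \<noteq> 0 \<Longrightarrow> x \<in> \<Omega> t" if "t \<ge> 0" for t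
    using assms(5) that closure_subset[of "{x. \<rho> t x \<noteq> 0}"] by (auto simp: compactly_supported_in_def)
  have norm_le: "norm x \<le> radius \<Omega> t" if "t \<ge> 0" "x \<in> \<Omega> t" for t x
    unfolding radius_def using compact_imp_bounded[OF \<Omega>(1)[OF that(1)]] that(2)
    by (intro cSUP_upper bounded_imp_bdd_above) (auto simp: bounded_norm_comp)
  have R: "radius \<Omega> t \<ge> 0" if "t \<ge> 0" for t
    using \<Omega>(2)[OF that] norm_le[OF that] by (meson all_not_in_conv norm_ge_zero order_trans)
  have M0: "M = total_mass t0"
    unfolding assms(7) mass_def total_mass_def set_lebesgue_integral_def
    using \<Omega>(3)[OF assms(6)] by (intro Bochner_Integration.integral_cong) (auto simp: indicator_def)
  have M: "total_mass t = M" if "t \<ge> 0" for t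
    using total_mass_constant[OF that assms(6)] M0 by simp
  have E0: "E = total_energy t0"
  proof -
    let ?t = t0
    have int: "integrable lborel (\<lambda>x. \<rho> ?t x * (u ?t x \<bullet> u ?t x))"
      "integrable lborel (\<lambda>x. \<rho> ?t x * \<Phi> ?t x)"
      by (intro integrable_\<rho> continuous_intros space_cont assms(6))+
    have intP: "integrable lborel (P ?t)"
      using integrable_P[OF assms(6) continuous_on_const, of 1] by simp
    have zero: "\<rho> ?t x = 0" if "x \<notin> \<Omega> ?t" for x using \<Omega>(3)[OF assms(6)] that by blast
    \<comment> \<open>Each term vanishes with \<rho>, the pressure because
      \<open>0 powr \<gamma> = 0\<close>, so the integral over \<open>\<Omega> t0\<close> extends to
      the whole space.\<close>
    have "E = (LINT x|lborel. 1 / 2 * (\<rho> ?t x * (u ?t x \<bullet> u ?t x)) + 1 / (\<gamma> - 1) * P ?t x - 1 / 2 * (\<rho> ?t x * \<Phi> ?t x))"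
      unfolding assms(8) energy_def set_lebesgue_integral_def
      using zero by (intro Bochner_Integration.integral_cong)
        (auto simp: indicator_def pressure_def power2_norm_eq_inner)
    also have "\<dots> = total_energy ?t"
      using int intP by (simp add: total_energy_def kinetic_def total_pressure_def self_energy_def newton_form_def newton_eq_potential)
    finally show ?thesis .
  qed
  have E: "total_energy t = E" if "t \<ge> 0" for t
    using total_energy_constant[OF that assms(6)] E0 by simp
  have inertia: "inertia t \<le> M * (radius \<Omega> t)\<^sup>2" if "t \<ge> 0" for t
    using inertia_le[OF that norm_le[OF that \<Omega>(3)[OF that]]] M[OF that] by simp
  show ?thesis
  proof (cases "M = 0")
    \<comment> \<open>Without mass every lower bound is 0, by division by zero or by
      \<open>0 powr (\<gamma> - 1) = 0\<close>, and it remains that the radius is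
      nonnegative.\<close>
    case True
    have "eventually (\<lambda>t. ereal 0 \<le> ereal (radius \<Omega> t / t)) at_top"
      using eventually_ge_at_top[of 0] by eventually_elim (simp add: R)
    then have "ereal 0 \<le> Liminf at_top (\<lambda>t. ereal (radius \<Omega> t / t))"
      by (rule Liminf_bounded)
    then show ?thesis using True by simp
  next
    case False
    then have Mpos: "M > 0" using total_mass_nonneg[OF assms(6)] M[OF assms(6)] by simp
    have growth: "ereal (sqrt (c / M)) \<le> Liminf at_top (\<lambda>t. ereal (radius \<Omega> t / t))"
      if "\<And>t. t \<ge> 0 \<Longrightarrow> kinetic t + real CARD('n) * total_pressure t + virial t \<ge> c" for c
    proof (rule Liminf_radius_bound[OF Mpos R, where T = 0])
      fix t :: real assume t: "0 \<le> t"
      show "inertia 0 + 2 * radial_momentum 0 * t + c * t\<^sup>2 \<le> M * (radius \<Omega> t)\<^sup>2"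
        using quadratic_growth[OF inertia_deriv radial_momentum_deriv that t] inertia[OF t] by linarith
    qed auto
    have 1: "ereal (sqrt (Min {2, real CARD('n) * (\<gamma> - 1), real CARD('n) - 2} * E / M))
        \<le> Liminf at_top (\<lambda>t. ereal (radius \<Omega> t / t))" if "CARD('n) \<ge> 3"
      using total_energy_le_virial[OF _ that] E by (intro growth) auto
    have 2: "ereal (sqrt (1 / (2 * M))) \<le> Liminf at_top (\<lambda>t. ereal (radius \<Omega> t / t))" if c2: "CARD('n) = 2"
    proof -
      have k: "M\<^sup>2 / 2 + kinetic t \<le> kinetic t + real CARD('n) * total_pressure t + virial t" if "t \<ge> 0" for t
        using virial_eq_2[OF that c2] M[OF that] total_pressure_nonneg[OF that] by simp
      \<comment> \<open>Growth is superlinear, so any slope can be reached; sqrt (1/2) makes the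
        coefficient of t^2 equal to 1/2, and division by M then gives the claimed constant.\<close>
      obtain T b where T: "T \<ge> 0" "\<And>t. t \<ge> T \<Longrightarrow> (b + sqrt (1 / 2) * t)\<^sup>2 \<le> inertia t + 1"
        by (rule superlinear_growth[OF inertia_deriv radial_momentum_deriv inertia_nonneg k radial_momentum_bound,
              of "sqrt (1/2)"]) (use Mpos in auto)
      have "ereal (sqrt ((1 / 2) / M)) \<le> Liminf at_top (\<lambda>t. ereal (radius \<Omega> t / t))"
      proof (rule Liminf_radius_bound[OF Mpos R T(1)])
        fix t assume t: "t \<ge> T"
        have "(b + sqrt (1 / 2) * t)\<^sup>2 = b\<^sup>2 + 2 * b * sqrt (1 / 2) * t + 1 / 2 * t\<^sup>2"
          by (simp add: power2_sum power_mult_distrib del: real_sqrt_divide)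
        then show "(b\<^sup>2 - 1) + 2 * b * sqrt (1 / 2) * t + 1 / 2 * t\<^sup>2 \<le> M * (radius \<Omega> t)\<^sup>2"
          using T(2)[OF t] inertia[of t] T(1) t by linarith
      qed
      then show ?thesis by simp
    qed
    have 3: "ereal (sqrt (real CARD('n) * K * M powr (\<gamma> - 1) / V powr (\<gamma> - 1)))
        \<le> Liminf at_top (\<lambda>t. ereal (radius \<Omega> t / t))" if V: "\<forall>t\<ge>0. measure lborel (\<Omega> t) = V" for V
    proof -
      \<comment> \<open>Of the second derivative only the pressure term N int P is kept; dividing
        its Jensen bound by M lowers the exponent of M to \<gamma> - 1.\<close>
      have "ereal (sqrt (real CARD('n) * (K * M powr \<gamma> / V powr (\<gamma> - 1)) / M))
          \<le> Liminf at_top (\<lambda>t. ereal (radius \<Omega> t / t))"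
      proof (rule growth)
        fix t :: real assume t: "t \<ge> 0"
        have "K * M powr \<gamma> / V powr (\<gamma> - 1) \<le> total_pressure t"
          using total_pressure_lower_bound[OF t _ \<Omega>(1)[OF t] \<Omega>(3)[OF t]] M[OF t] Mpos V t by simp
        then have "real CARD('n) * (K * M powr \<gamma> / V powr (\<gamma> - 1)) \<le> real CARD('n) * total_pressure t"
          by (rule mult_left_mono) simp
        then show "real CARD('n) * (K * M powr \<gamma> / V powr (\<gamma> - 1))
            \<le> kinetic t + real CARD('n) * total_pressure t + virial t"
          using kinetic_nonneg[OF t] virial_nonneg[OF t] by linarith
      qed
      moreover have "real CARD('n) * (K * M powr \<gamma> / V powr (\<gamma> - 1)) / M
          = real CARD('n) * K * M powr (\<gamma> - 1) / V powr (\<gamma> - 1)"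
        using Mpos by (simp add: powr_diff mult_ac)
      ultimately show ?thesis by simp
    qed
    show ?thesis using 1 2 3 by blast
  qed
qed

end
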